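(* Let $(X,d)$ be a compact metric space. Assume that $\phi:X\times[0,\infty)\to X$ is a continuous semiflow that is positive expansive. Then $X$ is a union of at most finitely many closed orbits of $\phi$, unbranched tails of $\phi$ and isolated singularities of $\phi$ (that is, singularities which are isolated points of $X$).
   Context: A continuous semiflow on a metric space $X$ is a continuous function $\phi:X\times[0,\infty)\to X$ such that $\phi(x,0)=x$ for all $x\in X$ and $\phi(x,t+s)=\phi(\phi(x,t),s)$ for all $x\in X$ and all $t,s\in[0,\infty)$. Write $\phi_t(x)=\phi(x,t)$. $H^+$ denotes the set of all functions $s:[0,\infty)\to[0,\infty)$ that are continuous, surjective, strictly increasing and satisfy $s(0)=0$. A continuous semiflow $\phi$ on $(X,d)$ is called positive expansive if for every $\varepsilon>0$ there exists $\delta>0$ such that for every pair of points $x,y$ in $X$ and every $s\in H^+$ such that $d(\phi_t(x),\phi_{s(t)}(y))<\delta$ for all $t\in[0,\infty)$, there exists $t_0\in[0,\varepsilon)$ such that $y=\phi_{t_0}(x)$ or $x=\phi_{t_0}(y)$. For $x\in X$, the positive orbit of $x$ is $O^+_\phi(x)=\{\phi_t(x):t\in[0,\infty)\}$, and the pre-orbit of $x$ is $O^-_\phi(x)=\{y\in X:\phi_t(y)=x\text{ for some }t\in[0,\infty)\}$. Define $\tau_x:O^-_\phi(x)\to[0,\infty)$ by $\tau_x(y)=\inf\{t\in[0,\infty):\phi_t(y)=x\}$. The pre-orbit $O^-_\phi(x)$ is called unbranched if $\tau_x$ is injective. A point $x\in X$ is periodic if there exists $t_0>0$ with $\phi_{t_0}(x)=x$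 and $O^+_\phi(x)\neq\{x\}$; in this case $O^+_\phi(x)$ is called a closed orbit of $\phi$. A point $x\in X$ is a singularity of $\phi$ if $O^+_\phi(x)=O^-_\phi(x)=\{x\}$. It is an end point of $\phi$ if $O^+_\phi(x)=\{x\}$ and $O^-_\phi(x)\neq\{x\}$. If $x$ is an end point, then $O^-_\phi(x)$ is called the tail of $x$ (a tail of $\phi$). *)

theory Defs
  imports "HOL-Analysis.Analysis"
begin

text \<open>
  The metric space is a subset \<open>X\<close> of a type of class \<open>metric_space\<close>, with the induced metric.
  A semiflow is a function on pairs, of which only the values on \<open>X \<times> {0..}\<close> matter.
\<close>

definition continuous_semiflow :: "'a::metric_space set \<Rightarrow> ('a \<times> real \<Rightarrow> 'a) \<Rightarrow> bool" where
  "continuous_semiflow X \<phi> \<longleftrightarrow>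
     \<phi> ` (X \<times> {0..}) \<subseteq> X \<and>
     continuous_on (X \<times> {0..}) \<phi> \<and>
     (\<forall>x\<in>X. \<phi> (x, 0) = x) \<and>
     (\<forall>x\<in>X. \<forall>t\<ge>0. \<forall>s\<ge>0. \<phi> (x, t + s) = \<phi> (\<phi> (x, t), s))"

text \<open>The set $H^+$; only the restriction of a member to \<open>{0..}\<close> matters.\<close>

definition Hplus :: "(real \<Rightarrow> real) set" where
  "Hplus = {s. continuous_on {0..} s \<and> s ` {0..} = {0..} \<and> strict_mono_on {0..} s \<and> s 0 = 0}"

definition positive_expansive :: "'a::metric_space set \<Rightarrow> ('a \<times> real \<Rightarrow> 'a) \<Rightarrow> bool" where
  "positive_expansive X \<phi> \<longleftrightarrow>
     (\<forall>\<epsilon>>0. \<exists>\<delta>>0. \<forall>x\<in>X. \<forall>y\<in>X. \<forall>s\<in>Hplus.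
        (\<forall>t\<ge>0. dist (\<phi> (x, t)) (\<phi> (y, s t)) < \<delta>) \<longrightarrow>
        (\<exists>t\<^sub>0\<in>{0..<\<epsilon>}. y = \<phi> (x, t\<^sub>0) \<or> x = \<phi> (y, t\<^sub>0)))"

definition pos_orbit :: "('a \<times> real \<Rightarrow> 'a) \<Rightarrow> 'a \<Rightarrow> 'a set" where
  "pos_orbit \<phi> x = {\<phi> (x, t) | t. t \<ge> 0}"

definition pre_orbit :: "'a set \<Rightarrow> ('a \<times> real \<Rightarrow> 'a) \<Rightarrow> 'a \<Rightarrow> 'a set" where
  "pre_orbit X \<phi> x = {y \<in> X. \<exists>t\<ge>0. \<phi> (y, t) = x}"

text \<open>Used only for \<open>y\<close> in the pre-orbit of \<open>x\<close>, where the infimum is over a nonempty set.\<close>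

definition hitting_time :: "('a \<times> real \<Rightarrow> 'a) \<Rightarrow> 'a \<Rightarrow> 'a \<Rightarrow> real" where
  "hitting_time \<phi> x y = Inf {t. t \<ge> 0 \<and> \<phi> (y, t) = x}"

definition unbranched :: "'a set \<Rightarrow> ('a \<times> real \<Rightarrow> 'a) \<Rightarrow> 'a \<Rightarrow> bool" where
  "unbranched X \<phi> x \<longleftrightarrow> inj_on (hitting_time \<phi> x) (pre_orbit X \<phi> x)"

definition periodic_point :: "'a set \<Rightarrow> ('a \<times> real \<Rightarrow> 'a) \<Rightarrow> 'a \<Rightarrow> bool" where
  "periodic_point X \<phi> x \<longleftrightarrow> x \<in> X \<and> (\<exists>t\<^sub>0>0. \<phi> (x, t\<^sub>0) = x) \<and> pos_orbit \<phi> x \<noteq> {x}"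

definition singularity :: "'a set \<Rightarrow> ('a \<times> real \<Rightarrow> 'a) \<Rightarrow> 'a \<Rightarrow> bool" where
  "singularity X \<phi> x \<longleftrightarrow> x \<in> X \<and> pos_orbit \<phi> x = {x} \<and> pre_orbit X \<phi> x = {x}"

definition end_point :: "'a set \<Rightarrow> ('a \<times> real \<Rightarrow> 'a) \<Rightarrow> 'a \<Rightarrow> bool" where
  "end_point X \<phi> x \<longleftrightarrow> x \<in> X \<and> pos_orbit \<phi> x = {x} \<and> pre_orbit X \<phi> x \<noteq> {x}"

definition closed_orbit :: "'a set \<Rightarrow> ('a \<times> real \<Rightarrow> 'a) \<Rightarrow> 'a set \<Rightarrow> bool" where
  "closed_orbit X \<phi> A \<longleftrightarrow> (\<exists>x. periodic_point X \<phi> x \<and> A = pos_orbit \<phi> x)"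

definition unbranched_tail :: "'a set \<Rightarrow> ('a \<times> real \<Rightarrow> 'a) \<Rightarrow> 'a set \<Rightarrow> bool" where
  "unbranched_tail X \<phi> A \<longleftrightarrow>
     (\<exists>x. end_point X \<phi> x \<and> unbranched X \<phi> x \<and> A = pre_orbit X \<phi> x)"

definition isolated_singularity :: "'a::topological_space set \<Rightarrow> ('a \<times> real \<Rightarrow> 'a) \<Rightarrow> 'a \<Rightarrow> bool" where
  "isolated_singularity X \<phi> x \<longleftrightarrow> singularity X \<phi> x \<and> x isolated_in X"

end

theory Submission
  imports Defs
begin

text \<open>
  A rest point attracts a whole neighbourhood in finite time: an orbit that lingers near it before
  leaving would be shadowed by a translate of itself. Hence there are finitely many rest points,
  the set of points that eventually come to rest is open, and it consists of isolated singularities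
  and tails; tails are unbranched because merging orbits shadow each other just before they merge.

  On the compact complement the semiflow has no rest points. There, orbits that merge coincide and
  bi-Lipschitz shadowing over a long time forces the initial points to be close up to a small time
  shift. So two close points have pasts that stay close up to reparametrization, and even get
  closer. As the future is expansive and the past is contracting, pigeonhole shows that every point
  is periodic and that nearby points lie on the same orbit.
\<close>

section \<open>Reparametrizations\<close>

text \<open>Two obstacles shape the part without rest points. Expansivity speaks of infinite time
  and of all of \<open>Hplus\<close>, which is not compact. With rates bounded by \<open>c\<close>,
  longer and longer finite shadowings have a limit, so conclusions about finite shadowing follow by
  contradiction.

  The other obstacle is loss of accuracy when a shadowing is extended into the past step by step.
  Each extension uses the length already shadowed to shift the partner point slightly, which makes
  the new starting points close again. Only the newest unit of time is reparametrized, so the rate 2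
  and the tolerance \<delta>/2 never deteriorate. Comparing two shadows of one common piece composes
  just two such reparametrizations; this is the origin of the rate 4 and the tolerance
  \<delta>.\<close>

lemma Hplus_id: "(\<lambda>t. t) \<in> Hplus"
  by (auto simp: Hplus_def strict_mono_on_def)

text \<open>Slope 1 after \<open>A\<close> suits the comparison of an orbit with its own translate:
  for \<open>B = A - 1\<close> the two agree exactly once time \<open>A\<close> is reached.\<close>

lemma Hplus_linear_then_shift:
  assumes "0 < A" "0 < B"
  shows "(\<lambda>t. if t \<le> A then t * B / A else t - A + B) \<in> Hplus" (is "?s \<in> _")
proof -
  have "continuous_on ({0..A} \<union> {A..}) ?s"
  proof (rule continuous_on_cases)
    show "continuous_on {0..A} (\<lambda>t. t * B / A)"
      using assms by (intro continuous_intros) auto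
    show "continuous_on {A..} (\<lambda>t. t - A + B)"
      by (intro continuous_intros)
  qed (use assms in auto)
  moreover have "{0..A} \<union> {A..} = {0..}" using assms by auto
  ultimately have "continuous_on {0..} ?s" by simp
  moreover have "?s t < ?s u" if "0 \<le> t" "t < u" for t u
  proof -
    consider "u \<le> A" | "t \<le> A" "A < u" | "A < t" by linarith
    then show ?thesis
    proof cases
      case 1 then show ?thesis using assms that by (auto simp: field_simps)
    next
      case 2
      then have "t * B / A \<le> B" using assms that by (auto simp: field_simps)
      then show ?thesis using 2 by auto
    qed (use that in auto)
  qed
  then have "strict_mono_on {0..} ?s" by (auto simp: strict_mono_on_def)
  moreover have "?s ` {0..} = {0..}"
  proof
    show "?s ` {0..} \<subseteq> {0..}" using assms by (auto simp: divide_simps)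
    show "{0..} \<subseteq> ?s ` {0..}"
    proof
      fix y :: real assume y: "y \<in> {0..}"
      show "y \<in> ?s ` {0..}"
      proof (cases "y \<le> B")
        case True
        then show ?thesis using y assms by (intro image_eqI[of _ _ "y * A / B"]) (auto simp: field_simps)
      next
        case False
        then show ?thesis using assms by (intro image_eqI[of _ _ "y - B + A"]) auto
      qed
    qed
  qed
  ultimately show ?thesis using assms by (simp add: Hplus_def)
qed

text \<open>Fixing the values on negative arguments leaves no freedom outside \<open>{0..}\<close>,
  so the set can be compact for pointwise convergence. The upper rate bounds the values; the lower
  rate keeps limits strictly increasing and unbounded, hence in \<open>Hplus\<close>.\<close>

definition bilip :: "real \<Rightarrow> (real \<Rightarrow> real) set" where
  "bilip c = {s. (\<forall>t\<le>0. s t = 0) \<and>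
     (\<forall>t u. 0 \<le> t \<and> t \<le> u \<longrightarrow> (u - t) / c \<le> s u - s t \<and> s u - s t \<le> c * (u - t))}"

lemma bilipD:
  assumes "s \<in> bilip c"
  shows "s 0 = 0"
    and "\<And>t u. 0 \<le> t \<Longrightarrow> t \<le> u \<Longrightarrow> (u - t) / c \<le> s u - s t"
    and "\<And>t u. 0 \<le> t \<Longrightarrow> t \<le> u \<Longrightarrow> s u - s t \<le> c * (u - t)"
  using assms by (auto simp: bilip_def)

lemma bilip_bounds:
  assumes "s \<in> bilip c" "0 \<le> t"
  shows "t / c \<le> s t" "s t \<le> c * t"
  using bilipD(2,3)[OF assms(1), of 0 t] assms(2) bilipD(1)[OF assms(1)] by auto

lemma bilip_nonneg: "s \<in> bilip c \<Longrightarrow> 0 < c \<Longrightarrow> 0 \<le> t \<Longrightarrow> 0 \<le> s t"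
  using bilip_bounds(1)[of s c t] divide_nonneg_pos[of t c] by linarith

lemma bilip_mono_arg: "s \<in> bilip c \<Longrightarrow> 0 < c \<Longrightarrow> 0 \<le> t \<Longrightarrow> t \<le> u \<Longrightarrow> s t \<le> s u"
  using bilipD(2)[of s c t u] divide_nonneg_pos[of "u - t" c] by linarith

lemma bilip_Hplus:
  assumes "s \<in> bilip c" "0 < c"
  shows "s \<in> Hplus"
proof -
  have "c-lipschitz_on {0..} s"
  proof (rule lipschitz_onI)
    fix t u :: real assume "t \<in> {0..}" "u \<in> {0..}"
    then show "dist (s t) (s u) \<le> c * dist t u"
      using bilipD(3)[OF assms(1), of t u] bilipD(3)[OF assms(1), of u t]
        bilip_mono_arg[OF assms, of t u] bilip_mono_arg[OF assms, of u t]
      by (cases "t \<le> u") (auto simp: dist_real_def abs_if)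
  qed (use assms in auto)
  then have cont: "continuous_on {0..} s" by (rule lipschitz_on_continuous_on)
  have "s t < s u" if "0 \<le> t" "t < u" for t u
    using bilipD(2)[OF assms(1), of t u] that assms(2) divide_pos_pos[of "u - t" c] by linarith
  then have mono: "strict_mono_on {0..} s" by (auto simp: strict_mono_on_def)
  have "y \<in> s ` {0..}" if "0 \<le> y" for y
  proof -
    have "y \<le> s (c * y)" using bilip_bounds(1)[OF assms(1), of "c * y"] that assms(2) by simp
    moreover have "continuous_on {0..c * y} s" using cont by (rule continuous_on_subset) auto
    ultimately have "\<exists>t\<ge>0. t \<le> c * y \<and> s t = y"
      using that assms(2) bilipD(1)[OF assms(1)] by (intro IVT') auto
    then show ?thesis by auto
  qed
  moreover have "s ` {0..} \<subseteq> {0..}" using bilip_nonneg[OF assms] by auto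
  ultimately have "s ` {0..} = {0..}" by auto
  with cont mono bilipD(1)[OF assms(1)] show ?thesis by (simp add: Hplus_def)
qed

lemma bilip_mono:
  assumes "c \<le> d" "0 < c"
  shows "bilip c \<subseteq> bilip d"
proof -
  have "t / d \<le> t / c" "c * t \<le> d * t" if "0 \<le> t" for t
    using that assms by (auto intro: divide_left_mono mult_right_mono)
  then show ?thesis unfolding bilip_def by (smt (verit, ccfv_SIG) mem_Collect_eq subsetI)
qed

lemma bilip_scale:
  assumes "1 / c \<le> k" "k \<le> c"
  shows "(\<lambda>t. k * max 0 t) \<in> bilip c"
proof -
  have "(u - t) / c \<le> k * (u - t)" "k * (u - t) \<le> c * (u - t)" if "t \<le> u" for t u
    using mult_right_mono[OF assms(1), of "u - t"] mult_right_mono[OF assms(2), of "u - t"] that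
    by auto
  then show ?thesis by (auto simp: bilip_def max_def right_diff_distrib)
qed

lemma bilip_concat:
  assumes s: "s \<in> bilip c" and r: "r \<in> bilip c" and A: "0 \<le> A" and "0 < c"
  shows "(\<lambda>t. if t \<le> A then s t else s A + r (t - A)) \<in> bilip c" (is "?f \<in> _")
proof -
  have "(u - t) / c \<le> ?f u - ?f t \<and> ?f u - ?f t \<le> c * (u - t)" if "0 \<le> t" "t \<le> u" for t u
  proof -
    consider "u \<le> A" | "t \<le> A" "A < u" | "A < t" by linarith
    then show ?thesis
    proof cases
      case 1 then show ?thesis using bilipD(2,3)[OF s, of t u] that by auto
    next
      case 2
      then have "(u - A) / c \<le> r (u - A)" "r (u - A) \<le> c * (u - A)"
        using bilip_bounds[OF r, of "u - A"] by auto
      moreover have "(A - t) / c \<le> s A - s t" "s A - s t \<le> c * (A - t)"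
        using bilipD(2,3)[OF s, of t A] 2 that by auto
      moreover have "(u - t) / c = (u - A) / c + (A - t) / c" "c * (u - t) = c * (u - A) + c * (A - t)"
        by (simp flip: add_divide_distrib) (simp add: right_diff_distrib)
      ultimately show ?thesis using 2 by auto
    next
      case 3
      then show ?thesis using bilipD(2,3)[OF r, of "t - A" "u - A"] that by auto
    qed
  qed
  moreover have "?f t = 0" if "t \<le> 0" for t using that A s by (auto simp: bilip_def)
  ultimately show ?thesis unfolding bilip_def by blast
qed

lemma bilip_comp:
  assumes s: "s \<in> bilip c" and r: "r \<in> bilip d" and c: "0 < c" and d: "0 < d"
  shows "r \<circ> s \<in> bilip (c * d)"
proof -
  have "(u - t) / (c * d) \<le> r (s u) - r (s t) \<and> r (s u) - r (s t) \<le> c * d * (u - t)"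
    if "0 \<le> t" "t \<le> u" for t u
  proof -
    have st: "0 \<le> s t" "s t \<le> s u" using bilip_nonneg[OF s c] bilip_mono_arg[OF s c] that by auto
    have "(u - t) / c / d \<le> (s u - s t) / d"
      using bilipD(2)[OF s that] d by (intro divide_right_mono) auto
    also have "\<dots> \<le> r (s u) - r (s t)" using bilipD(2)[OF r st] .
    finally have 1: "(u - t) / (c * d) \<le> r (s u) - r (s t)" by simp
    have "r (s u) - r (s t) \<le> d * (s u - s t)" using bilipD(3)[OF r st] .
    also have "\<dots> \<le> d * (c * (u - t))" using bilipD(3)[OF s that] d by (intro mult_left_mono) auto
    finally show ?thesis using 1 by (simp add: mult_ac)
  qed
  moreover have "r (s t) = 0" if "t \<le> 0" for t using that s r by (auto simp: bilip_def)
  ultimately show ?thesis unfolding bilip_def by auto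
qed

text \<open>Inversion exchanges the two rate bounds, so the same constant serves. This makes
  shadowing symmetric.\<close>

lemma bilip_inverse:
  assumes s: "s \<in> bilip c" and c: "0 < c"
  obtains r where "r \<in> bilip c" "\<And>t. 0 \<le> t \<Longrightarrow> s (r t) = t" "\<And>t. 0 \<le> t \<Longrightarrow> r (s t) = t"
proof -
  have H: "s ` {0..} = {0..}" "inj_on s {0..}" "s 0 = 0"
    using bilip_Hplus[OF s c] by (auto simp: Hplus_def strict_mono_on_imp_inj_on)
  define r where "r t = inv_into {0..} s (max 0 t)" for t
  have r1: "s (r t) = t" "0 \<le> r t" if "0 \<le> t" for t
    using f_inv_into_f[of t s "{0..}"] inv_into_into[of t s "{0..}"] H(1) that by (auto simp: r_def)
  have r2: "r (s t) = t" if "0 \<le> t" for t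
    using inv_into_f_f[OF H(2), of t] that bilip_nonneg[OF s c that] by (simp add: r_def)
  have r0: "r t = 0" if "t \<le> 0" for t
    using inv_into_f_f[OF H(2), of 0] H(3) that by (simp add: r_def max_absorb1)
  have "(u - t) / c \<le> r u - r t \<and> r u - r t \<le> c * (u - t)" if tu: "0 \<le> t" "t \<le> u" for t u
  proof -
    have le: "r t \<le> r u"
    proof (rule ccontr)
      assume "\<not> r t \<le> r u"
      then have "s (r u) \<le> s (r t)" "r u \<noteq> r t" using bilip_mono_arg[OF s c, of "r u" "r t"] r1[of u] tu by auto
      then show False using r1 tu by force
    qed
    have "(r u - r t) / c \<le> u - t" "u - t \<le> c * (r u - r t)"
      using bilipD(2,3)[OF s _ le] r1 tu by auto
    then show ?thesis using c by (auto simp: field_simps)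
  qed
  with r0 have "r \<in> bilip c" by (simp add: bilip_def)
  with r1 r2 show thesis using that by blast
qed

text \<open>Every condition is an equation or a non-strict inequality between finitely many values
  of \<open>s\<close>, hence survives pointwise limits.\<close>

lemma closed_bilip: "closed (bilip c)"
proof -
  have coord: "continuous_on UNIV (\<lambda>s::real \<Rightarrow> real. s t)" for t by simp
  show ?thesis unfolding bilip_def
    by (intro closed_Collect_conj closed_Collect_all closed_Collect_imp closed_Collect_eq
        closed_Collect_le continuous_intros open_Collect_const coord)
qed

text \<open>Tychonoff's theorem: the upper rate confines the value at \<open>t\<close> to a compact
  interval.\<close>

lemma compact_bilip:
  assumes "0 < c"
  shows "compact (bilip c)"
proof -
  define P where "P = (PiE UNIV (\<lambda>t. {0..c * max 0 t}) :: (real \<Rightarrow> real) set)"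
  have "compactin (product_topology (\<lambda>_. euclidean) UNIV) P"
    unfolding P_def by (subst compactin_PiE) auto
  then have "compact P" by (simp add: euclidean_product_topology)
  moreover have "bilip c \<subseteq> P"
  proof
    fix s assume s: "s \<in> bilip c"
    have "s t \<in> {0..c * max 0 t}" for t
    proof (cases "t \<le> 0")
      case True then show ?thesis using s by (auto simp: bilip_def)
    next
      case False then show ?thesis using bilip_bounds[OF s, of t] bilip_nonneg[OF s assms, of t] by auto
    qed
    then show "s \<in> P" by (auto simp: P_def)
  qed
  ultimately show ?thesis using closed_bilip[of c] by (metis compact_Int_closed inf.absorb2)
qed

section \<open>Semiflows on compact spaces\<close>

lemma separate_compact:
  fixes S T :: "'a::metric_space set"
  assumes "compact S" "compact T" "S \<inter> T = {}"
  shows "\<exists>d>0. \<forall>x\<in>S. \<forall>y\<in>T. d \<le> dist x y"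
proof (cases "S \<times> T = {}")
  case True
  then show ?thesis by (intro exI[of _ 1]) auto
next
  case False
  have "continuous_on (S \<times> T) (\<lambda>z. dist (fst z) (snd z))" by (intro continuous_intros)
  then obtain z where z: "z \<in> S \<times> T" "\<And>z'. z' \<in> S \<times> T \<Longrightarrow> dist (fst z) (snd z) \<le> dist (fst z') (snd z')"
    using continuous_attains_inf[OF compact_Times[OF assms(1,2)] False] by blast
  then have "0 < dist (fst z) (snd z)" using assms(3) by auto
  moreover have "dist (fst z) (snd z) \<le> dist x y" if "x \<in> S" "y \<in> T" for x y
    using z(2)[of "(x, y)"] that by simp
  ultimately show ?thesis by blast
qed

locale compact_semiflow =
  fixes X :: "'a::metric_space set" and \<phi> :: "'a \<times> real \<Rightarrow> 'a"
  assumes compact_X: "compact X" and semiflow: "continuous_semiflow X \<phi>"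
begin

lemma flow_in [simp]: "x \<in> X \<Longrightarrow> 0 \<le> t \<Longrightarrow> \<phi> (x, t) \<in> X"
  using semiflow by (auto simp: continuous_semiflow_def)

lemma flow_0 [simp]: "x \<in> X \<Longrightarrow> \<phi> (x, 0) = x"
  using semiflow by (auto simp: continuous_semiflow_def)

lemma flow_add: "x \<in> X \<Longrightarrow> 0 \<le> t \<Longrightarrow> 0 \<le> s \<Longrightarrow> \<phi> (\<phi> (x, t), s) = \<phi> (x, t + s)"
  using semiflow by (auto simp: continuous_semiflow_def)

lemma continuous_on_flow [continuous_intros]:
  assumes "continuous_on S f" "continuous_on S g" "\<And>z. z \<in> S \<Longrightarrow> f z \<in> X" "\<And>z. z \<in> S \<Longrightarrow> 0 \<le> g z"
  shows "continuous_on S (\<lambda>z. \<phi> (f z, g z))"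
proof -
  have "continuous_on (X \<times> {0..}) \<phi>" using semiflow by (simp add: continuous_semiflow_def)
  then show ?thesis
    by (rule continuous_on_compose2) (use assms in \<open>auto intro!: continuous_intros\<close>)
qed

lemma flow_uniform:
  assumes "0 < e"
  obtains d where "0 < d"
    "\<And>x y t u. \<lbrakk>x \<in> X; y \<in> X; t \<in> {0..T}; u \<in> {0..T}; dist x y < d; \<bar>t - u\<bar> < d\<rbrakk>
      \<Longrightarrow> dist (\<phi> (x, t)) (\<phi> (y, u)) < e"
proof -
  have "continuous_on (X \<times> {0..T}) (\<lambda>z. \<phi> (fst z, snd z))"
    by (intro continuous_intros) auto
  then have "uniformly_continuous_on (X \<times> {0..T}) \<phi>"
    using compact_X by (intro compact_uniformly_continuous compact_Times) auto
  then obtain d where d: "0 < d"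
    "\<And>z z'. z \<in> X \<times> {0..T} \<Longrightarrow> z' \<in> X \<times> {0..T} \<Longrightarrow> dist z' z < d \<Longrightarrow> dist (\<phi> z') (\<phi> z) < e"
    using assms unfolding uniformly_continuous_on_def by blast
  show thesis
  proof (rule that[of "d / 2"])
    fix x y t u
    assume *: "x \<in> X" "y \<in> X" "t \<in> {0..T}" "u \<in> {0..T}" "dist x y < d / 2" "\<bar>t - u\<bar> < d / 2"
    have "dist (x, t) (y, u) \<le> dist x y + dist t u"
      unfolding dist_Pair_Pair using sqrt_sum_squares_le_sum by force
    then have "dist (x, t) (y, u) < d" using * by (simp add: dist_real_def)
    then show "dist (\<phi> (x, t)) (\<phi> (y, u)) < e" using d(2)[of "(y, u)" "(x, t)"] * by auto
  qed (use d in auto)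
qed

lemma flow_tendsto:
  assumes "f \<longlonglongrightarrow> x" "g \<longlonglongrightarrow> t" "\<And>n. f n \<in> X" "\<And>n. 0 \<le> g n" "x \<in> X" "0 \<le> t"
  shows "(\<lambda>n. \<phi> (f n, g n)) \<longlonglongrightarrow> \<phi> (x, t)"
proof -
  have "continuous_on (X \<times> {0..}) \<phi>" using semiflow by (simp add: continuous_semiflow_def)
  then show ?thesis
    by (rule continuous_on_tendsto_compose) (use assms in \<open>auto intro!: tendsto_Pair\<close>)
qed

text \<open>The bound is uniform over unbounded times because the point at the earlier time may be
  taken as the new starting point, which leaves a time in \<open>{0..1}\<close>.\<close>

lemma small_time_displacement:
  assumes "0 < e"
  obtains h where "0 < h"
    "\<And>x t u. \<lbrakk>x \<in> X; 0 \<le> t; 0 \<le> u; \<bar>t - u\<bar> \<le> h\<rbrakk> \<Longrightarrow> dist (\<phi> (x, t)) (\<phi> (x, u)) < e"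
proof -
  obtain d where d: "0 < d" "\<And>x y t u. \<lbrakk>x \<in> X; y \<in> X; t \<in> {0..1}; u \<in> {0..1}; dist x y < d; \<bar>t - u\<bar> < d\<rbrakk>
      \<Longrightarrow> dist (\<phi> (x, t)) (\<phi> (y, u)) < e"
    using flow_uniform[OF assms] by metis
  define h where "h = min (1/2) (d / 2)"
  have h: "0 < h" "h < d" "h \<le> 1" using d(1) by (auto simp: h_def)
  have *: "dist (\<phi> (x, t)) (\<phi> (x, u)) < e" if "x \<in> X" "0 \<le> t" "t \<le> u" "u - t \<le> h" for x t u
  proof -
    have "dist (\<phi> (\<phi> (x, t), 0)) (\<phi> (\<phi> (x, t), u - t)) < e"
      using that h d(1) by (intro d(2)) auto
    then show ?thesis using that by (simp add: flow_add)
  qed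
  show thesis
  proof (rule that[OF h(1)])
    fix x t u assume "x \<in> X" "0 \<le> t" "0 \<le> u" "\<bar>t - u\<bar> \<le> h"
    then show "dist (\<phi> (x, t)) (\<phi> (x, u)) < e"
      using *[of x t u] *[of x u t] by (cases "t \<le> u") (auto simp: dist_commute)
  qed
qed

text \<open>An orbit that meets itself is periodic from then on, so a later time can be reduced
  modulo \<open>b - a\<close>.\<close>

lemma flow_return:
  assumes "x \<in> X" "0 \<le> a" "a < b" "\<phi> (x, a) = \<phi> (x, b)" "a \<le> t"
  obtains t' where "a \<le> t'" "t' < b" "\<phi> (x, t) = \<phi> (x, t')"
proof -
  define P where "P = b - a"
  have P: "0 < P" using assms by (simp add: P_def)
  have shift: "\<phi> (x, u) = \<phi> (x, u + P)" if "a \<le> u" for u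
    using flow_add[OF assms(1,2), of "u - a"] flow_add[OF assms(1), of b "u - a"] that assms
    by (simp add: P_def algebra_simps)
  have shifts: "\<phi> (x, u) = \<phi> (x, u + real n * P)" if "a \<le> u" for u n
  proof (induction n)
    case (Suc n)
    have "a \<le> u + real n * P" using that P by (simp add: add_increasing2)
    from shift[OF this] Suc show ?case by (simp add: algebra_simps)
  qed simp
  define n where "n = nat \<lfloor>(t - a) / P\<rfloor>"
  have "real n \<le> (t - a) / P" "(t - a) / P < real n + 1"
    using assms(5) P by (auto simp: n_def)
  then have n: "real n * P \<le> t - a" "t - a < real n * P + P"
    using P by (auto simp: field_simps)
  show thesis
    by (rule that[of "t - real n * P"]) (use n shifts[of "t - real n * P" n] in \<open>auto simp: P_def\<close>)
qed

section \<open>Periodic orbits\<close>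

lemma pos_orbit_refl: "x \<in> X \<Longrightarrow> x \<in> pos_orbit \<phi> x"
  unfolding pos_orbit_def using flow_0 by force

lemma pos_orbit_trans: "x \<in> X \<Longrightarrow> y \<in> pos_orbit \<phi> x \<Longrightarrow> pos_orbit \<phi> y \<subseteq> pos_orbit \<phi> x"
  unfolding pos_orbit_def by (force simp: flow_add)

lemma periodic_multiple:
  assumes "x \<in> X" "0 < P" "\<phi> (x, P) = x"
  shows "\<phi> (x, real n * P) = x"
proof (induction n)
  case (Suc n)
  have "\<phi> (x, real (Suc n) * P) = \<phi> (\<phi> (x, real n * P), P)"
    using assms(1,2) by (subst flow_add) (auto simp: algebra_simps)
  then show ?case using Suc assms(3) by simp
qed (use assms in auto)

lemma periodic_late_return:
  assumes "x \<in> X" "0 < P" "\<phi> (x, P) = x"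
  obtains t where "b \<le> t" "0 \<le> t" "\<phi> (x, t) = x"
proof -
  obtain n where "b / P \<le> real n" using real_arch_simple by blast
  then have "b \<le> real n * P" using assms(2) by (simp add: field_simps)
  then show thesis using that periodic_multiple[OF assms] assms(2) by auto
qed

lemma periodic_pos_orbit_sym:
  assumes "x \<in> X" "0 < P" "\<phi> (x, P) = x" "y \<in> pos_orbit \<phi> x"
  shows "x \<in> pos_orbit \<phi> y"
proof -
  obtain t where t: "0 \<le> t" "y = \<phi> (x, t)" using assms(4) by (auto simp: pos_orbit_def)
  obtain u where u: "t \<le> u" "\<phi> (x, u) = x" using periodic_late_return[OF assms(1-3)] by metis
  then have "x = \<phi> (y, u - t)" using t assms(1) by (simp add: flow_add)
  then show ?thesis using u by (auto simp: pos_orbit_def)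
qed

lemma periodic_compact_pos_orbit:
  assumes "x \<in> X" "0 < P" "\<phi> (x, P) = x"
  shows "compact (pos_orbit \<phi> x)"
proof -
  have "pos_orbit \<phi> x = (\<lambda>t. \<phi> (x, t)) ` {0..P}"
  proof
    show "pos_orbit \<phi> x \<subseteq> (\<lambda>t. \<phi> (x, t)) ` {0..P}"
    proof
      fix y assume "y \<in> pos_orbit \<phi> x"
      then obtain t where t: "0 \<le> t" "y = \<phi> (x, t)" by (auto simp: pos_orbit_def)
      obtain t' where "0 \<le> t'" "t' < P" "\<phi> (x, t) = \<phi> (x, t')"
        using flow_return[of x 0 P t] assms t(1) by auto
      then show "y \<in> (\<lambda>t. \<phi> (x, t)) ` {0..P}" using t by auto
    qed
  qed (auto simp: pos_orbit_def)
  moreover have "continuous_on {0..P} (\<lambda>t. \<phi> (x, t))"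
    using assms(1) by (intro continuous_intros) auto
  ultimately show ?thesis by (simp add: compact_continuous_image)
qed

end

section \<open>Rest points and tails\<close>

locale expansive_semiflow = compact_semiflow +
  assumes expansive: "positive_expansive X \<phi>"
begin

lemma expansiveE:
  assumes "0 < \<epsilon>"
  obtains \<delta> where "0 < \<delta>"
    "\<And>x y s. \<lbrakk>x \<in> X; y \<in> X; s \<in> Hplus; \<And>t. 0 \<le> t \<Longrightarrow> dist (\<phi> (x, t)) (\<phi> (y, s t)) < \<delta>\<rbrakk>
      \<Longrightarrow> \<exists>t\<^sub>0\<in>{0..<\<epsilon>}. y = \<phi> (x, t\<^sub>0) \<or> x = \<phi> (y, t\<^sub>0)"
  using expansive assms unfolding positive_expansive_def by metis

definition rest_points :: "'a set" where
  "rest_points = {p \<in> X. \<forall>t\<ge>0. \<phi> (p, t) = p}"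

lemma rest_points_in: "p \<in> rest_points \<Longrightarrow> p \<in> X"
  and rest_points_fixed: "p \<in> rest_points \<Longrightarrow> 0 \<le> t \<Longrightarrow> \<phi> (p, t) = p"
  by (auto simp: rest_points_def)

text \<open>
  An orbit that starts near \<open>p\<close> and later leaves a small ball around \<open>p\<close> spends a long time in
  that ball. There it is shadowed by its own translate by one time unit, which makes it periodic
  with a short period, so that it never leaves the ball.
\<close>

lemma rest_point_attracting:
  assumes p: "p \<in> rest_points"
  obtains \<eta> where "0 < \<eta>" "\<And>x. x \<in> X \<Longrightarrow> dist x p < \<eta> \<Longrightarrow> \<exists>t\<ge>0. \<phi> (x, t) = p"
proof -
  obtain \<delta> where \<delta>: "0 < \<delta>"
    "\<And>x y s. \<lbrakk>x \<in> X; y \<in> X; s \<in> Hplus; \<And>t. 0 \<le> t \<Longrightarrow> dist (\<phi> (x, t)) (\<phi> (y, s t)) < \<delta>\<rbrakk>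
      \<Longrightarrow> \<exists>t\<^sub>0\<in>{0..<1/2}. y = \<phi> (x, t\<^sub>0) \<or> x = \<phi> (y, t\<^sub>0)"
    using expansiveE[of "1/2"] by auto
  define r where "r = \<delta> / 3"
  have r: "0 < r" "2 * r < \<delta>" using \<delta>(1) by (auto simp: r_def)
  obtain \<eta> where \<eta>: "0 < \<eta>"
    "\<And>x y t u. \<lbrakk>x \<in> X; y \<in> X; t \<in> {0..3}; u \<in> {0..3}; dist x y < \<eta>; \<bar>t - u\<bar> < \<eta>\<rbrakk>
      \<Longrightarrow> dist (\<phi> (x, t)) (\<phi> (y, u)) < r"
    using flow_uniform[OF r(1)] by metis
  have start: "dist (\<phi> (x, t)) p < r" if "x \<in> X" "dist x p < \<eta>" "0 \<le> t" "t \<le> 3" for x t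
    using \<eta>(2)[of x p t t] that \<eta>(1) p rest_points_in rest_points_fixed by auto
  have stay: "dist (\<phi> (x, t)) p < r" if x: "x \<in> X" "dist x p < \<eta>" and t: "0 \<le> t" for x t
  proof (rule ccontr)
    assume far: "\<not> dist (\<phi> (x, t)) p < r"
    define B where "B = {u \<in> {0..t}. r \<le> dist (\<phi> (x, u)) p}"
    have "continuous_on {0..t} (\<lambda>u. dist (\<phi> (x, u)) p)"
      using x by (intro continuous_intros) auto
    then have "closed B"
      unfolding B_def using x by (intro continuous_on_closed_Collect_le continuous_intros) auto
    moreover have "t \<in> B" "bdd_below B" using far t by (auto simp: B_def)
    ultimately have "Inf B \<in> B" by (intro closed_contains_Inf) auto
    define T where "T = Inf B"
    have T: "T \<in> B" "\<And>u. u \<in> B \<Longrightarrow> T \<le> u"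
      using \<open>Inf B \<in> B\<close> \<open>bdd_below B\<close> by (auto simp: T_def cInf_lower)
    have T3: "3 < T" using start[OF x, of T] T(1) by (force simp: B_def)
    have before: "dist (\<phi> (x, u)) p < r" if "0 \<le> u" "u < T" for u
      using T(2)[of u] T(1) that by (force simp: B_def)
    \<comment> \<open>\<open>T\<close> is the first exit time. Before \<open>T\<close> both the
      point and its translate are in the ball; \<open>s\<close> takes \<open>T\<close> to
      \<open>T - 1\<close>, so from \<open>T\<close> on the two orbits coincide.\<close>
    define s where "s = (\<lambda>u. if u \<le> T then u * (T - 1) / T else u - T + (T - 1))"
    have "s \<in> Hplus" unfolding s_def using T3 by (intro Hplus_linear_then_shift) auto
    moreover have "dist (\<phi> (x, u)) (\<phi> (\<phi> (x, 1), s u)) < \<delta>" if u: "0 \<le> u" for u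
    proof -
      have su: "0 \<le> s u" using u T3 by (auto simp: s_def)
      then have eq: "\<phi> (\<phi> (x, 1), s u) = \<phi> (x, 1 + s u)" using x by (simp add: flow_add)
      show ?thesis
      proof (cases "u < T")
        case True
        then have "u * (T - 1) < T * (T - 1)" using T3 by simp
        then have "s u < T - 1" using True T3 by (simp add: s_def divide_simps mult.commute)
        then have "dist (\<phi> (x, 1 + s u)) p < r" using su by (intro before) auto
        then have "dist (\<phi> (x, u)) (\<phi> (x, 1 + s u)) < r + r"
          using before[OF u True] by (smt (verit) dist_triangle2)
        then show ?thesis using r eq by simp
      next
        case False
        then have "1 + s u = u" using T3 by (cases "u = T") (auto simp: s_def)
        then show ?thesis using eq \<delta>(1) by simp
      qed
    qed
    ultimately obtain t\<^sub>0 where t0: "0 \<le> t\<^sub>0" "t\<^sub>0 < 1/2"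
      and "\<phi> (x, 1) = \<phi> (x, t\<^sub>0) \<or> x = \<phi> (\<phi> (x, 1), t\<^sub>0)"
      using \<delta>(2)[of x "\<phi> (x, 1)" s] x by auto
    \<comment> \<open>The tolerance 1/2 is smaller than the translation by 1, so in both cases the
      orbit meets itself at two different times before 2. The position at \<open>T\<close> is then
      one already taken before time 3, when the orbit was still in the ball.\<close>
    then obtain a b where ab: "0 \<le> a" "a < b" "b < 2" "\<phi> (x, a) = \<phi> (x, b)"
    proof (elim disjE)
      assume "\<phi> (x, 1) = \<phi> (x, t\<^sub>0)"
      then show thesis using that[of t\<^sub>0 1] t0 by auto
    next
      assume "x = \<phi> (\<phi> (x, 1), t\<^sub>0)"
      then show thesis using that[of 0 "1 + t\<^sub>0"] t0 x by (auto simp: flow_add)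
    qed
    obtain t' where "a \<le> t'" "t' < b" "\<phi> (x, T) = \<phi> (x, t')"
      using flow_return[OF x(1) ab(1,2,4), of T] ab T3 by auto
    then have "dist (\<phi> (x, T)) p < r" using start[OF x, of t'] ab by auto
    then show False using T(1) by (auto simp: B_def)
  qed
  show thesis
  proof (rule that[OF \<eta>(1)])
    fix x assume x: "x \<in> X" "dist x p < \<eta>"
    have "dist (\<phi> (x, t)) (\<phi> (p, t)) < \<delta>" if "0 \<le> t" for t
      using stay[OF x that] p rest_points_fixed r that by auto
    from \<delta>(2)[OF x(1) rest_points_in[OF p] Hplus_id this] obtain t\<^sub>0
      where "0 \<le> t\<^sub>0" "p = \<phi> (x, t\<^sub>0) \<or> x = \<phi> (p, t\<^sub>0)" by auto
    then show "\<exists>t\<ge>0. \<phi> (x, t) = p"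
      using p rest_points_fixed x by (metis flow_0 order_refl)
  qed
qed

text \<open>Rest points closer than the expansivity constant shadow each other trivially, lie on one
  orbit and hence coincide. A uniformly separated subset of a totally bounded set is finite.\<close>

lemma finite_rest_points: "finite rest_points"
proof -
  obtain \<delta> where \<delta>: "0 < \<delta>"
    "\<And>x y s. \<lbrakk>x \<in> X; y \<in> X; s \<in> Hplus; \<And>t. 0 \<le> t \<Longrightarrow> dist (\<phi> (x, t)) (\<phi> (y, s t)) < \<delta>\<rbrakk>
      \<Longrightarrow> \<exists>t\<^sub>0\<in>{0..<1}. y = \<phi> (x, t\<^sub>0) \<or> x = \<phi> (y, t\<^sub>0)"
    using expansiveE[of 1] by auto
  have sep: "p = q" if "p \<in> rest_points" "q \<in> rest_points" "dist p q < \<delta>" for p q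
  proof -
    have "dist (\<phi> (p, t)) (\<phi> (q, t)) < \<delta>" if "0 \<le> t" for t
      using that \<open>dist p q < \<delta>\<close> \<open>p \<in> _\<close> \<open>q \<in> _\<close> by (simp add: rest_points_fixed)
    from \<delta>(2)[OF _ _ Hplus_id this] show ?thesis
      using that by (auto simp: rest_points_in rest_points_fixed)
  qed
  obtain C where C: "finite C" "X \<subseteq> (\<Union>c\<in>C. ball c (\<delta> / 2))"
    using compact_X \<delta>(1) unfolding compact_eq_totally_bounded by (meson half_gt_zero)
  have "finite (rest_points \<inter> ball c (\<delta> / 2))" for c
  proof (cases "rest_points \<inter> ball c (\<delta> / 2) = {}")
    case False
    then obtain p where p: "p \<in> rest_points" "dist c p < \<delta> / 2" by auto
    have "q = p" if "q \<in> rest_points \<inter> ball c (\<delta> / 2)" for q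
      using that p by (intro sep) (auto intro: dist_triangle_half_r)
    then have "rest_points \<inter> ball c (\<delta> / 2) \<subseteq> {p}" by auto
    then show ?thesis by (rule finite_subset) simp
  qed (use finite.emptyI in metis)
  then have "finite (\<Union>c\<in>C. rest_points \<inter> ball c (\<delta> / 2))" using C(1) by blast
  moreover have "rest_points \<subseteq> (\<Union>c\<in>C. rest_points \<inter> ball c (\<delta> / 2))"
    using C(2) rest_points_in by fastforce
  ultimately show ?thesis by (rule rev_finite_subset)
qed

text \<open>Just before two orbits merge they shadow each other, hence lie on one orbit.\<close>

lemma merging_orbits:
  assumes uv: "u \<in> X" "v \<in> X" "u \<noteq> v" and c: "0 \<le> c" "\<phi> (u, c) = \<phi> (v, c)" and "0 < \<epsilon>"
  obtains a t\<^sub>0 where "0 \<le> a" "a < c" "0 < t\<^sub>0" "t\<^sub>0 < \<epsilon>"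
    "\<phi> (v, a) = \<phi> (u, a + t\<^sub>0) \<or> \<phi> (u, a) = \<phi> (v, a + t\<^sub>0)"
proof -
  obtain \<delta> where \<delta>: "0 < \<delta>"
    "\<And>x y s. \<lbrakk>x \<in> X; y \<in> X; s \<in> Hplus; \<And>t. 0 \<le> t \<Longrightarrow> dist (\<phi> (x, t)) (\<phi> (y, s t)) < \<delta>\<rbrakk>
      \<Longrightarrow> \<exists>t\<^sub>0\<in>{0..<\<epsilon>}. y = \<phi> (x, t\<^sub>0) \<or> x = \<phi> (y, t\<^sub>0)"
    using expansiveE[OF \<open>0 < \<epsilon>\<close>] by auto
  obtain h where h: "0 < h"
    "\<And>x t u. \<lbrakk>x \<in> X; 0 \<le> t; 0 \<le> u; \<bar>t - u\<bar> \<le> h\<rbrakk> \<Longrightarrow> dist (\<phi> (x, t)) (\<phi> (x, u)) < \<delta> / 2"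
    using small_time_displacement[of "\<delta> / 2"] \<delta>(1) by auto
  define M where "M = {t \<in> {0..c}. dist (\<phi> (u, t)) (\<phi> (v, t)) \<le> 0}"
  have "closed M"
    unfolding M_def using uv by (intro continuous_on_closed_Collect_le continuous_intros) auto
  moreover have cM: "c \<in> M" "bdd_below M" using c by (auto simp: M_def)
  ultimately have "Inf M \<in> M" by (intro closed_contains_Inf) auto
  define m where "m = Inf M"
  have m: "m \<in> M" "\<And>t. t \<in> M \<Longrightarrow> m \<le> t"
    using \<open>Inf M \<in> M\<close> cM by (auto simp: m_def cInf_lower)
  have "0 \<notin> M" using uv by (simp add: M_def)
  then have m0: "0 < m" "m \<le> c" "\<phi> (u, m) = \<phi> (v, m)" using m(1) by (auto simp: M_def less_le)
  \<comment> \<open>Within \<open>h\<close> of the first meeting time \<open>m\<close> both orbits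
    are within \<delta>/2 of the meeting point. As \<open>a\<close> is before \<open>m\<close>, the
    points still differ there, which makes the shift found below positive.\<close>
  define a where "a = max 0 (m - h)"
  have a: "0 \<le> a" "a < m" "m - a \<le> h" using m0 h(1) by (auto simp: a_def)
  have ne: "\<phi> (u, a) \<noteq> \<phi> (v, a)" using m(2)[of a] a m0(2) by (auto simp: M_def)
  have "dist (\<phi> (\<phi> (u, a), t)) (\<phi> (\<phi> (v, a), t)) < \<delta>" if t: "0 \<le> t" for t
  proof (cases "a + t \<le> m")
    case True
    have "dist (\<phi> (u, a + t)) (\<phi> (u, m)) < \<delta> / 2" "dist (\<phi> (v, a + t)) (\<phi> (v, m)) < \<delta> / 2"
      using h uv a t True by auto
    then have "dist (\<phi> (u, a + t)) (\<phi> (v, a + t)) < \<delta>"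
      using m0(3) by (metis dist_triangle_half_l)
    then show ?thesis using uv a t by (simp add: flow_add)
  next
    case False
    have "\<phi> (u, a + t) = \<phi> (\<phi> (u, m), a + t - m)" "\<phi> (v, a + t) = \<phi> (\<phi> (v, m), a + t - m)"
      using flow_add[of u m "a + t - m"] flow_add[of v m "a + t - m"] uv m0 False by auto
    then show ?thesis using uv a t m0 \<delta>(1) by (simp add: flow_add)
  qed
  from \<delta>(2)[OF _ _ Hplus_id this] obtain t\<^sub>0 where t0: "0 \<le> t\<^sub>0" "t\<^sub>0 < \<epsilon>"
    "\<phi> (v, a) = \<phi> (\<phi> (u, a), t\<^sub>0) \<or> \<phi> (u, a) = \<phi> (\<phi> (v, a), t\<^sub>0)" using uv a by auto
  then have "t\<^sub>0 \<noteq> 0" using ne uv a by auto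
  then show thesis using that[of a t\<^sub>0] t0 a m0 uv by (auto simp: flow_add)
qed

text \<open>The infimum in \<open>hitting_time\<close> is attained because the times spent at
  \<open>p\<close> form a closed set. If two different points had the same hitting time, then
  shortly before they merge one would be ahead on the orbit of the other by some
  \<open>t\<^sub>0 > 0\<close>, and so would reach \<open>p\<close> too early.\<close>

lemma rest_point_unbranched:
  assumes p: "p \<in> rest_points"
  shows "unbranched X \<phi> p"
proof -
  have hit: "\<phi> (u, hitting_time \<phi> p u) = p" "0 \<le> hitting_time \<phi> p u"
    "\<And>t. 0 \<le> t \<Longrightarrow> \<phi> (u, t) = p \<Longrightarrow> hitting_time \<phi> p u \<le> t"
    if u: "u \<in> pre_orbit X \<phi> p" for u
  proof -
    define M where "M = {t. 0 \<le> t \<and> \<phi> (u, t) = p}"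
    have uX: "u \<in> X" and ne: "M \<noteq> {}" using u by (auto simp: pre_orbit_def M_def)
    have "M = {t \<in> {0..}. dist (\<phi> (u, t)) p \<le> 0}" by (auto simp: M_def)
    moreover have "closed {t \<in> {0..}. dist (\<phi> (u, t)) p \<le> 0}"
      using uX by (intro continuous_on_closed_Collect_le continuous_intros) auto
    ultimately have "closed M" by simp
    moreover have bdd: "bdd_below M" by (auto simp: M_def)
    ultimately have "Inf M \<in> M" using ne by (intro closed_contains_Inf)
    moreover have "hitting_time \<phi> p u = Inf M" by (simp add: hitting_time_def M_def)
    ultimately show "\<phi> (u, hitting_time \<phi> p u) = p" "0 \<le> hitting_time \<phi> p u"
      by (auto simp: M_def)
    show "hitting_time \<phi> p u \<le> t" if "0 \<le> t" "\<phi> (u, t) = p" for t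
      using that bdd \<open>hitting_time \<phi> p u = Inf M\<close> by (auto simp: M_def intro!: cInf_lower)
  qed
  have no_delay: False
    if u: "u \<in> pre_orbit X \<phi> p" and v: "v \<in> pre_orbit X \<phi> p"
      and eq: "hitting_time \<phi> p u = c" "hitting_time \<phi> p v = c"
      and a: "0 \<le> a" "a < c" "0 < t\<^sub>0" "\<phi> (v, a) = \<phi> (u, a + t\<^sub>0)" for u v c a t\<^sub>0
  proof (cases "c \<le> a + t\<^sub>0")
    case True
    have uX: "u \<in> X" using u by (simp add: pre_orbit_def)
    have "\<phi> (u, a + t\<^sub>0) = \<phi> (\<phi> (u, c), a + t\<^sub>0 - c)" using uX a True by (simp add: flow_add)
    then have "\<phi> (v, a) = p" using hit(1)[OF u] eq(1) p True a(4) by (simp add: rest_points_fixed)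
    then show False using hit(3)[OF v a(1)] eq(2) a(2) by simp
  next
    case False
    have X: "u \<in> X" "v \<in> X" using u v by (auto simp: pre_orbit_def)
    have "\<phi> (v, c - t\<^sub>0) = \<phi> (\<phi> (v, a), c - t\<^sub>0 - a)"
      using flow_add[of v a "c - t\<^sub>0 - a"] X a(1) False by simp
    also have "\<dots> = \<phi> (u, c)"
      using flow_add[of u "a + t\<^sub>0" "c - t\<^sub>0 - a"] X a(1,3,4) False by simp
    finally have "\<phi> (v, c - t\<^sub>0) = p" using hit(1)[OF u] eq(1) by simp
    then show False using hit(3)[OF v, of "c - t\<^sub>0"] eq(2) a False by simp
  qed
  show ?thesis unfolding unbranched_def
  proof (rule inj_onI, rule ccontr)
    fix u v assume u: "u \<in> pre_orbit X \<phi> p" and v: "v \<in> pre_orbit X \<phi> p"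
      and eq: "hitting_time \<phi> p u = hitting_time \<phi> p v" and "u \<noteq> v"
    have X: "u \<in> X" "v \<in> X" using u v by (auto simp: pre_orbit_def)
    define c where "c = hitting_time \<phi> p v"
    have c: "0 \<le> c" "\<phi> (u, c) = \<phi> (v, c)"
      using hit(1,2)[OF v] hit(1)[OF u] eq by (simp_all add: c_def)
    from merging_orbits[OF X \<open>u \<noteq> v\<close> c zero_less_one] obtain a t\<^sub>0
      where a: "0 \<le> a" "a < c" "0 < t\<^sub>0"
        and "\<phi> (v, a) = \<phi> (u, a + t\<^sub>0) \<or> \<phi> (u, a) = \<phi> (v, a + t\<^sub>0)" .
    then show False
      using no_delay[OF u v eq[folded c_def] c_def[symmetric] a]
        no_delay[OF v u c_def[symmetric] eq[folded c_def] a] by blast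
  qed
qed

section \<open>The part of the space that never comes to rest\<close>

definition restless_points :: "'a set" where
  "restless_points = {x \<in> X. \<forall>t\<ge>0. \<phi> (x, t) \<notin> rest_points}"

text \<open>If \<open>x\<close> is at a rest point at time \<open>t\<close>, continuity carries a
  neighbourhood of \<open>x\<close> at time \<open>t\<close> into the ball attracted by that rest
  point. So the complement is open in \<open>X\<close>.\<close>

lemma compact_restless_points: "compact restless_points"
proof -
  have "openin (top_of_set X) (X - restless_points)"
  proof (subst openin_euclidean_subtopology_iff, intro conjI ballI)
    fix x assume "x \<in> X - restless_points"
    then obtain t where x: "x \<in> X" and t: "0 \<le> t" "\<phi> (x, t) \<in> rest_points"
      by (auto simp: restless_points_def)
    obtain \<eta> where \<eta>: "0 < \<eta>"
      "\<And>y. y \<in> X \<Longrightarrow> dist y (\<phi> (x, t)) < \<eta> \<Longrightarrow> \<exists>u\<ge>0. \<phi> (y, u) = \<phi> (x, t)"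
      using rest_point_attracting[OF t(2)] by metis
    obtain d where d: "0 < d"
      "\<And>x y a b. \<lbrakk>x \<in> X; y \<in> X; a \<in> {0..t}; b \<in> {0..t}; dist x y < d; \<bar>a - b\<bar> < d\<rbrakk>
        \<Longrightarrow> dist (\<phi> (x, a)) (\<phi> (y, b)) < \<eta>"
      using flow_uniform[OF \<eta>(1), of t] by metis
    have "y \<in> X - restless_points" if y: "y \<in> X" "dist y x < d" for y
    proof -
      have "dist (\<phi> (y, t)) (\<phi> (x, t)) < \<eta>" using d x y t by auto
      then obtain u where "0 \<le> u" "\<phi> (\<phi> (y, t), u) = \<phi> (x, t)" using \<eta>(2)[of "\<phi> (y, t)"] y t by auto
      then show ?thesis using y t by (auto simp: flow_add restless_points_def intro!: exI[of _ "t + u"])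
    qed
    then show "\<exists>e>0. \<forall>y\<in>X. dist y x < e \<longrightarrow> y \<in> X - restless_points" using d(1) by blast
  qed auto
  then have "closedin (top_of_set X) restless_points"
    by (simp add: closedin_def restless_points_def)
  then show ?thesis using compact_X by (rule closedin_compact[rotated])
qed

lemma restless_points_invariant:
  assumes "x \<in> restless_points" "0 \<le> t"
  shows "\<phi> (x, t) \<in> restless_points"
  using assms by (auto simp: restless_points_def flow_add)

end

section \<open>Shadowing\<close>

context compact_semiflow
begin

text \<open>
  The rate bound \<open>c\<close> makes the admissible reparametrizations a compact set, unlike \<open>Hplus\<close>.
\<close>

definition shadows :: "real \<Rightarrow> real \<Rightarrow> real \<Rightarrow> real \<Rightarrow> 'a \<Rightarrow> 'a \<Rightarrow> bool" where
  "shadows c b A B x y \<longleftrightarrow>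
     (\<exists>s\<in>bilip c. s A = B \<and> (\<forall>t\<in>{0..A}. dist (\<phi> (x, t)) (\<phi> (y, s t)) \<le> b))"

lemma shadows_length:
  assumes "shadows c b A B x y" "0 \<le> A"
  shows "A / c \<le> B" "B \<le> c * A"
  using assms bilip_bounds unfolding shadows_def by blast+

lemma shadows_mono:
  assumes "shadows c b A B x y" "0 < c" "c \<le> c'" "b \<le> b'"
  shows "shadows c' b' A B x y"
  using assms bilip_mono[OF assms(3,2)] unfolding shadows_def by (meson in_mono order_trans)

lemma shadows_sym:
  assumes "shadows c b A B x y" "0 < c" "0 \<le> A"
  shows "shadows c b B A y x"
proof -
  obtain s where s: "s \<in> bilip c" "s A = B" "\<And>t. t \<in> {0..A} \<Longrightarrow> dist (\<phi> (x, t)) (\<phi> (y, s t)) \<le> b"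
    using assms(1) unfolding shadows_def by auto
  obtain r where r: "r \<in> bilip c" "\<And>t. 0 \<le> t \<Longrightarrow> s (r t) = t" "\<And>t. 0 \<le> t \<Longrightarrow> r (s t) = t"
    using bilip_inverse[OF s(1) assms(2)] by blast
  have rB: "r B = A" using r(3) assms(3) s(2) by blast
  have "dist (\<phi> (y, t)) (\<phi> (x, r t)) \<le> b" if "t \<in> {0..B}" for t
  proof -
    have "r t \<le> A" using bilip_mono_arg[OF r(1) assms(2), of t B] rB that by auto
    then show ?thesis
      using s(3)[of "r t"] r(2)[of t] bilip_nonneg[OF r(1) assms(2), of t] that
      by (auto simp: dist_commute)
  qed
  then show ?thesis using r(1) rB unfolding shadows_def by blast
qed

lemma shadows_trans:
  assumes "shadows c b A B x y" "shadows d b' B C y z" "0 < c" "0 < d" "0 \<le> A"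
  shows "shadows (c * d) (b + b') A C x z"
proof -
  obtain s where s: "s \<in> bilip c" "s A = B" "\<And>t. t \<in> {0..A} \<Longrightarrow> dist (\<phi> (x, t)) (\<phi> (y, s t)) \<le> b"
    using assms(1) unfolding shadows_def by auto
  obtain r where r: "r \<in> bilip d" "r B = C" "\<And>t. t \<in> {0..B} \<Longrightarrow> dist (\<phi> (y, t)) (\<phi> (z, r t)) \<le> b'"
    using assms(2) unfolding shadows_def by auto
  have "dist (\<phi> (x, t)) (\<phi> (z, (r \<circ> s) t)) \<le> b + b'" if t: "t \<in> {0..A}" for t
  proof -
    have "s t \<in> {0..B}"
      using bilip_mono_arg[OF s(1) assms(3), of t A] bilip_nonneg[OF s(1) assms(3), of t] s(2) t by auto
    then show ?thesis
      using s(3)[OF t] r(3)[of "s t"] dist_triangle[of "\<phi> (x, t)" "\<phi> (z, r (s t))" "\<phi> (y, s t)"] by auto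
  qed
  then show ?thesis
    using bilip_comp[OF s(1) r(1) assms(3,4)] s(2) r(2) unfolding shadows_def
    by (intro bexI[of _ "r \<circ> s"]) auto
qed

text \<open>Unlike composition in \<open>shadows_trans\<close>, gluing changes neither the rate nor
  the tolerance. This is what allows arbitrarily long shadowings with fixed constants.\<close>

lemma shadows_concat:
  assumes "shadows c b A B x y" "shadows c b A' B' (\<phi> (x, A)) (\<phi> (y, B))"
    and "0 < c" "0 \<le> A" "0 \<le> A'" "x \<in> X" "y \<in> X"
  shows "shadows c b (A + A') (B + B') x y"
proof -
  obtain s where s: "s \<in> bilip c" "s A = B" "\<And>t. t \<in> {0..A} \<Longrightarrow> dist (\<phi> (x, t)) (\<phi> (y, s t)) \<le> b"
    using assms(1) unfolding shadows_def by auto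
  obtain r where r: "r \<in> bilip c" "r A' = B'"
    "\<And>t. t \<in> {0..A'} \<Longrightarrow> dist (\<phi> (\<phi> (x, A), t)) (\<phi> (\<phi> (y, B), r t)) \<le> b"
    using assms(2) unfolding shadows_def by auto
  define q where "q = (\<lambda>t. if t \<le> A then s t else s A + r (t - A))"
  have "q \<in> bilip c" unfolding q_def using s r assms by (intro bilip_concat)
  moreover have "q (A + A') = B + B'"
    using s(2) r(2) bilipD(1)[OF r(1)] assms(5) by (cases "A' = 0") (auto simp: q_def)
  moreover have "dist (\<phi> (x, t)) (\<phi> (y, q t)) \<le> b" if "t \<in> {0..A + A'}" for t
  proof (cases "t \<le> A")
    case True then show ?thesis using s(3)[of t] that by (auto simp: q_def)
  next
    case False
    have "0 \<le> B" "0 \<le> r (t - A)"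
      using bilip_nonneg[OF s(1) assms(3,4)] bilip_nonneg[OF r(1) assms(3), of "t - A"] s(2) False by auto
    then show ?thesis using r(3)[of "t - A"] that False s(2) assms by (auto simp: q_def flow_add)
  qed
  ultimately show ?thesis unfolding shadows_def by blast
qed

lemma shadows_linear:
  assumes "0 < A" "0 \<le> B" "A / c \<le> B" "B \<le> c * A" "0 < c"
    and "\<And>u. u \<in> {0..1} \<Longrightarrow> dist (\<phi> (x, u * A)) (\<phi> (y, u * B)) \<le> b"
  shows "shadows c b A B x y"
proof -
  have "(\<lambda>t. B / A * max 0 t) \<in> bilip c"
    using assms(1-5) by (intro bilip_scale) (auto simp: field_simps)
  moreover have "dist (\<phi> (x, t)) (\<phi> (y, B / A * max 0 t)) \<le> b" if "t \<in> {0..A}" for t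
    using assms(6)[of "t / A"] that assms(1) by (simp add: max_absorb2 mult.commute)
  ultimately show ?thesis
    using assms(1) unfolding shadows_def by (intro bexI[of _ "\<lambda>t. B / A * max 0 t"]) auto
qed

lemma shadows_0:
  assumes "shadows c b A B x y" "0 \<le> A" "x \<in> X" "y \<in> X"
  shows "dist x y \<le> b"
  using assms bilipD(1) unfolding shadows_def by force

lemma shadows_trivial:
  assumes "dist x y \<le> b" "x \<in> X" "y \<in> X" "1 \<le> c"
  shows "shadows c b 0 0 x y"
proof -
  have "(\<lambda>t. 1 * max 0 t) \<in> bilip c" using assms(4) by (intro bilip_scale) auto
  then show ?thesis using assms unfolding shadows_def by (intro bexI[of _ "\<lambda>t. 1 * max 0 t"]) auto
qed

end

text \<open>\<open>T\<close> serves twice, as the tolerance in expansivity and as a lower bound for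
  return times, so a positive shift supplied by expansivity is never a return. The bound \<delta> is
  non-strict in order to survive limits. Injectivity of the time maps is the substitute for running
  time backwards.\<close>

locale regular_semiflow = compact_semiflow +
  fixes T \<delta> :: real
  assumes T_pos: "0 < T" and no_return: "\<And>x t. \<lbrakk>x \<in> X; 0 < t; t \<le> T\<rbrakk> \<Longrightarrow> \<phi> (x, t) \<noteq> x"
    and \<delta>_pos: "0 < \<delta>"
    and expansivity:
      "\<And>x y s. \<lbrakk>x \<in> X; y \<in> X; s \<in> Hplus; \<And>t. 0 \<le> t \<Longrightarrow> dist (\<phi> (x, t)) (\<phi> (y, s t)) \<le> \<delta>\<rbrakk>
        \<Longrightarrow> \<exists>t\<^sub>0\<in>{0..<T}. y = \<phi> (x, t\<^sub>0) \<or> x = \<phi> (y, t\<^sub>0)"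
    and flow_inj: "\<And>x y t. \<lbrakk>x \<in> X; y \<in> X; 0 \<le> t; \<phi> (x, t) = \<phi> (y, t)\<rbrakk> \<Longrightarrow> x = y"

text \<open>Arbitrarily short periods would yield a rest point in the limit, since the multiples of
  a short period come close to every time; this gives \<open>T\<close>. Two merging orbits would
  differ by a positive shift below \<open>T\<close> just before they merge, and this shift would
  become a forbidden return at the merging point; this gives injectivity.\<close>

lemma (in expansive_semiflow) regular_if_no_rest_points:
  assumes "rest_points = {}"
  obtains T \<delta> where "regular_semiflow X \<phi> T \<delta>"
proof -
  have "\<exists>T>0. \<forall>x\<in>X. \<forall>t. 0 < t \<and> t \<le> T \<longrightarrow> \<phi> (x, t) \<noteq> x"
  proof (rule ccontr)
    assume "\<not> ?thesis"
    then have "\<forall>n. \<exists>x t. x \<in> X \<and> 0 < t \<and> t \<le> 1 / real (Suc n) \<and> \<phi> (x, t) = x"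
      by (metis of_nat_0_less_iff zero_less_Suc zero_less_divide_1_iff)
    then obtain f g where fg: "\<And>n. f n \<in> X" "\<And>n::nat. 0 < g n" "\<And>n. g n \<le> 1 / real (Suc n)"
      "\<And>n. \<phi> (f n, g n) = f n" by metis
    obtain x k where x: "x \<in> X" "strict_mono k" "(f \<circ> k) \<longlonglongrightarrow> x"
      using compact_X fg(1) unfolding compact_eq_seq_compact_metric seq_compact_def by metis
    have "\<phi> (x, t) = x" if t: "0 \<le> t" for t
    proof -
      define m where "m n = nat \<lfloor>t / g n\<rfloor>" for n
      have m: "real (m n) * g n \<le> t" "t - g n < real (m n) * g n" for n
      proof -
        have "real (m n) \<le> t / g n" "t / g n < real (m n) + 1"
          using t fg(2)[of n] by (auto simp: m_def)
        then show "real (m n) * g n \<le> t" "t - g n < real (m n) * g n"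
          using fg(2)[of n] by (auto simp: field_simps)
      qed
      have per: "\<phi> (f n, real j * g n) = f n" for n j
      proof (induction j)
        case (Suc j)
        have "\<phi> (f n, real (Suc j) * g n) = \<phi> (\<phi> (f n, real j * g n), g n)"
          using fg(1,2)[of n] by (subst flow_add) (auto simp: algebra_simps)
        then show ?case using Suc fg(4) by simp
      qed (use fg in auto)
      have "(\<lambda>n. real (m n) * g n) \<longlonglongrightarrow> t"
      proof (rule tendsto_sandwich)
        show "\<forall>\<^sub>F n in sequentially. t - 1 / real (Suc n) \<le> real (m n) * g n"
          using m(2) fg(3) by (intro always_eventually) (smt (verit))
        show "(\<lambda>n. t - 1 / real (Suc n)) \<longlonglongrightarrow> t"
          using tendsto_diff[OF tendsto_const LIMSEQ_inverse_real_of_nat, of t] by (simp add: inverse_eq_divide)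
      qed (use m(1) in auto)
      then have "((\<lambda>n. real (m n) * g n) \<circ> k) \<longlonglongrightarrow> t" using x(2) by (rule LIMSEQ_subseq_LIMSEQ)
      then have "(\<lambda>n. \<phi> ((f \<circ> k) n, ((\<lambda>n. real (m n) * g n) \<circ> k) n)) \<longlonglongrightarrow> \<phi> (x, t)"
        using x t fg(1) fg(2)[THEN less_imp_le] by (intro flow_tendsto) (auto simp: comp_def)
      then have "(f \<circ> k) \<longlonglongrightarrow> \<phi> (x, t)" using per by (simp add: comp_def)
      then show ?thesis using x(3) LIMSEQ_unique by blast
    qed
    then show False using assms x(1) by (auto simp: rest_points_def)
  qed
  then obtain T where T: "0 < T" "\<And>x t. \<lbrakk>x \<in> X; 0 < t; t \<le> T\<rbrakk> \<Longrightarrow> \<phi> (x, t) \<noteq> x" by metis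
  obtain \<delta> where \<delta>: "0 < \<delta>"
    "\<And>x y s. \<lbrakk>x \<in> X; y \<in> X; s \<in> Hplus; \<And>t. 0 \<le> t \<Longrightarrow> dist (\<phi> (x, t)) (\<phi> (y, s t)) < \<delta>\<rbrakk>
      \<Longrightarrow> \<exists>t\<^sub>0\<in>{0..<T}. y = \<phi> (x, t\<^sub>0) \<or> x = \<phi> (y, t\<^sub>0)"
    using expansiveE[OF T(1)] by auto
  have no_delay: False
    if "u \<in> X" "v \<in> X" "0 \<le> a" "a < c" "0 < t\<^sub>0" "t\<^sub>0 < T" "\<phi> (u, c) = \<phi> (v, c)"
      "\<phi> (v, a) = \<phi> (u, a + t\<^sub>0)" for u v a c t\<^sub>0
  proof -
    have "\<phi> (v, c) = \<phi> (\<phi> (v, a), c - a)" using that(1-7) by (simp add: flow_add)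
    also have "\<dots> = \<phi> (u, c + t\<^sub>0)" unfolding that(8) using that(1-7) by (simp add: flow_add add.commute)
    also have "\<dots> = \<phi> (\<phi> (u, c), t\<^sub>0)" using that(1-6) by (simp add: flow_add)
    finally show False using T(2)[of "\<phi> (u, c)" t\<^sub>0] that(1-7) by simp
  qed
  have inj: "u = v" if uv: "u \<in> X" "v \<in> X" and c: "0 \<le> c" "\<phi> (u, c) = \<phi> (v, c)" for u v c
  proof (rule ccontr)
    assume "u \<noteq> v"
    from merging_orbits[OF uv this c T(1)] obtain a t\<^sub>0 where "0 \<le> a" "a < c" "0 < t\<^sub>0" "t\<^sub>0 < T"
      "\<phi> (v, a) = \<phi> (u, a + t\<^sub>0) \<or> \<phi> (u, a) = \<phi> (v, a + t\<^sub>0)" .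
    then show False using no_delay[of u v a c t\<^sub>0] no_delay[of v u a c t\<^sub>0] uv c by auto
  qed
  show thesis
  proof (rule that[of T "\<delta> / 2"], unfold_locales)
    fix x y s assume *: "x \<in> X" "y \<in> X" "s \<in> Hplus"
      and le: "\<And>t. 0 \<le> t \<Longrightarrow> dist (\<phi> (x, t)) (\<phi> (y, s t)) \<le> \<delta> / 2"
    have "dist (\<phi> (x, t)) (\<phi> (y, s t)) < \<delta>" if "0 \<le> t" for t using le[OF that] \<delta>(1) by linarith
    then show "\<exists>t\<^sub>0\<in>{0..<T}. y = \<phi> (x, t\<^sub>0) \<or> x = \<phi> (y, t\<^sub>0)" using \<delta>(2)[OF *] by blast
  qed (use T \<delta>(1) inj in auto)
qed

section \<open>Shadowing in the absence of rest points\<close>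

context regular_semiflow
begin

text \<open>Counterexamples of growing length form a decreasing sequence of nonempty closed subsets
  of the compact set \<open>X \<times> X \<times> bilip c\<close>. A common element would shadow for
  all time; expansivity then puts its two points on one orbit with a shift below \<open>T\<close>,
  which the sets exclude.\<close>

lemma shadows_imp_near:
  assumes "0 < c" "0 < \<eta>"
  obtains N where "0 \<le> N"
    "\<And>x y A B. \<lbrakk>x \<in> X; y \<in> X; N \<le> A; shadows c \<delta> A B x y\<rbrakk>
      \<Longrightarrow> \<exists>\<tau>\<in>{0..T}. dist y (\<phi> (x, \<tau>)) < \<eta> \<or> dist x (\<phi> (y, \<tau>)) < \<eta>"
proof (rule ccontr)
  assume contr: "\<not> thesis"
  define Z where "Z = X \<times> X \<times> bilip c"
  define D where "D = (\<lambda>t (z :: 'a \<times> 'a \<times> (real \<Rightarrow> real)).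
    dist (\<phi> (fst z, t)) (\<phi> (fst (snd z), snd (snd z) t)))"
  define E where "E = (\<lambda>n::nat. (\<Inter>t\<in>{0..real n}. {z \<in> Z. D t z \<le> \<delta>}) \<inter>
     (\<Inter>\<tau>\<in>{0..T}. {z \<in> Z. \<eta> \<le> dist (fst (snd z)) (\<phi> (fst z, \<tau>))}) \<inter>
     (\<Inter>\<tau>\<in>{0..T}. {z \<in> Z. \<eta> \<le> dist (fst z) (\<phi> (fst (snd z), \<tau>))}))"
  have Z: "compact Z" "closed Z"
    using compact_X compact_bilip[OF assms(1)] compact_imp_closed[OF compact_X] closed_bilip
    by (auto simp: Z_def intro!: compact_Times closed_Times)
  have coord: "continuous_on Z (\<lambda>z. snd (snd z) t)" for t
  proof -
    have "continuous_on Z (\<lambda>z. snd (snd z))" by (intro continuous_intros)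
    then show ?thesis
      by (rule continuous_on_compose2[OF continuous_on_product_coordinates]) auto
  qed
  have "continuous_on Z (D t)" if "0 \<le> t" for t
    unfolding D_def
    by (intro continuous_intros coord) (use that bilip_nonneg assms(1) in \<open>auto simp: Z_def\<close>)
  then have closed_D: "closed {z \<in> Z. D t z \<le> \<delta>}" if "0 \<le> t" for t
    using that Z by (intro continuous_on_closed_Collect_le continuous_intros) auto
  have cont_\<eta>: "continuous_on Z (\<lambda>z. dist (fst (snd z)) (\<phi> (fst z, \<tau>)))"
    "continuous_on Z (\<lambda>z. dist (fst z) (\<phi> (fst (snd z), \<tau>)))" if "0 \<le> \<tau>" for \<tau>
    by (intro continuous_intros; use that in \<open>auto simp: Z_def\<close>)+
  have closed_\<eta>: "closed {z \<in> Z. \<eta> \<le> dist (fst (snd z)) (\<phi> (fst z, \<tau>))}"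
    "closed {z \<in> Z. \<eta> \<le> dist (fst z) (\<phi> (fst (snd z), \<tau>))}" if "0 \<le> \<tau>" for \<tau>
    by (intro continuous_on_closed_Collect_le continuous_on_const cont_\<eta> Z(2) \<open>0 \<le> \<tau>\<close>)+
  have E_ne: "E n \<noteq> {}" for n
  proof -
    have "\<exists>x\<in>X. \<exists>y\<in>X. \<exists>A\<ge>real n. \<exists>B. shadows c \<delta> A B x y \<and>
      (\<forall>\<tau>\<in>{0..T}. \<eta> \<le> dist y (\<phi> (x, \<tau>)) \<and> \<eta> \<le> dist x (\<phi> (y, \<tau>)))"
    proof (rule ccontr)
      assume "\<not> ?thesis"
      then have "\<exists>\<tau>\<in>{0..T}. dist y (\<phi> (x, \<tau>)) < \<eta> \<or> dist x (\<phi> (y, \<tau>)) < \<eta>"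
        if "x \<in> X" "y \<in> X" "real n \<le> A" "shadows c \<delta> A B x y" for x y A B
        using that by (meson not_le)
      then have thesis by (rule that[OF of_nat_0_le_iff])
      with contr show False by blast
    qed
    then obtain x y A B where *: "x \<in> X" "y \<in> X" "real n \<le> A" "shadows c \<delta> A B x y"
      "\<And>\<tau>. \<tau> \<in> {0..T} \<Longrightarrow> \<eta> \<le> dist y (\<phi> (x, \<tau>)) \<and> \<eta> \<le> dist x (\<phi> (y, \<tau>))"
      by blast
    then obtain s where "s \<in> bilip c" "\<And>t. t \<in> {0..A} \<Longrightarrow> dist (\<phi> (x, t)) (\<phi> (y, s t)) \<le> \<delta>"
      unfolding shadows_def by blast
    with * have "(x, y, s) \<in> E n" by (auto simp: E_def Z_def D_def)
    then show ?thesis by blast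
  qed
  have "Z \<inter> (\<Inter>n\<in>UNIV. E n) \<noteq> {}"
  proof (rule compact_imp_fip_image[OF Z(1)])
    show "closed (E n)" for n
      unfolding E_def using closed_D closed_\<eta> by (intro closed_Int closed_INT) auto
    fix I :: "nat set" assume I: "finite I"
    define m where "m = Max (insert 0 I)"
    have "E m \<subseteq> E n" if "n \<in> I" for n
    proof -
      have "real n \<le> real m" using I that by (simp add: m_def)
      then show ?thesis unfolding E_def by fastforce
    qed
    moreover have "E m \<subseteq> Z" unfolding E_def by force
    ultimately have "E m \<subseteq> Z \<inter> (\<Inter>n\<in>I. E n)" by blast
    then show "Z \<inter> (\<Inter>n\<in>I. E n) \<noteq> {}" using E_ne[of m] by blast
  qed
  then obtain z where "z \<in> Z" "\<And>n. z \<in> E n" by blast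
  then obtain x y s where z: "(x, y, s) \<in> Z" "\<And>n. (x, y, s) \<in> E n" by (metis prod_cases3)
  have "dist (\<phi> (x, t)) (\<phi> (y, s t)) \<le> \<delta>" if "0 \<le> t" for t
    using z(2)[of "nat \<lceil>t\<rceil>"] that by (auto simp: E_def D_def of_nat_ceiling)
  then obtain t\<^sub>0 where "t\<^sub>0 \<in> {0..<T}" "y = \<phi> (x, t\<^sub>0) \<or> x = \<phi> (y, t\<^sub>0)"
    using expansivity[of x y s] z(1) bilip_Hplus[OF _ assms(1), of s] by (auto simp: Z_def)
  moreover have "\<eta> \<le> dist y (\<phi> (x, t\<^sub>0))" "\<eta> \<le> dist x (\<phi> (y, t\<^sub>0))"
    using z(2)[of 0] \<open>t\<^sub>0 \<in> {0..<T}\<close> by (auto simp: E_def)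
  ultimately show False using assms(2) by auto
qed

lemma displacement_pos:
  assumes "0 < e"
  obtains \<gamma> where "0 < \<gamma>" "\<And>x t. \<lbrakk>x \<in> X; e \<le> t; t \<le> T\<rbrakk> \<Longrightarrow> \<gamma> \<le> dist (\<phi> (x, t)) x"
proof (cases "X \<times> {e..T} = {}")
  case True
  then show thesis using that[of 1] by auto
next
  case False
  have "continuous_on (X \<times> {e..T}) (\<lambda>z. dist (\<phi> (fst z, snd z)) (fst z))"
    using assms by (intro continuous_intros) auto
  moreover have "compact (X \<times> {e..T})" using compact_X by (intro compact_Times) auto
  ultimately obtain z where z: "z \<in> X \<times> {e..T}"
    "\<And>z'. z' \<in> X \<times> {e..T} \<Longrightarrow> dist (\<phi> z) (fst z) \<le> dist (\<phi> z') (fst z')"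
    using continuous_attains_inf[OF _ False] by fastforce
  show thesis
  proof (rule that[of "dist (\<phi> z) (fst z)"])
    show "0 < dist (\<phi> z) (fst z)" using z(1) no_return assms by force
    show "dist (\<phi> z) (fst z) \<le> dist (\<phi> (x, t)) x" if "x \<in> X" "e \<le> t" "t \<le> T" for x t
      using z(2)[of "(x, t)"] that by auto
  qed
qed

text \<open>
  For orbits that start close together the time shift is small: it is at most \<open>T\<close>, and no point
  almost returns within the times between \<open>e\<close> and \<open>T\<close>.
\<close>

lemma shadows_imp_near_small_shift:
  assumes "0 < c" "0 < e"
  obtains \<gamma> where "0 < \<gamma>"
    "\<And>\<eta>. 0 < \<eta> \<Longrightarrow> \<exists>N. \<forall>x\<in>X. \<forall>y\<in>X. \<forall>A\<ge>N. \<forall>B. shadows c \<delta> A B x y \<and> dist x y < \<gamma> \<longrightarrow>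
      (\<exists>\<tau>\<in>{0..<e}. dist y (\<phi> (x, \<tau>)) < \<eta> \<or> dist x (\<phi> (y, \<tau>)) < \<eta>)"
proof -
  obtain \<gamma> where \<gamma>: "0 < \<gamma>" "\<And>x t. \<lbrakk>x \<in> X; e \<le> t; t \<le> T\<rbrakk> \<Longrightarrow> \<gamma> \<le> dist (\<phi> (x, t)) x"
    using displacement_pos[OF assms(2)] by metis
  have small: "\<tau> < e" if "x \<in> X" "y \<in> X" "dist x y < \<gamma> / 2" "dist y (\<phi> (x, \<tau>)) < \<gamma> / 2" "\<tau> \<le> T" for x y \<tau>
  proof (rule ccontr)
    assume "\<not> \<tau> < e"
    then have "\<gamma> \<le> dist (\<phi> (x, \<tau>)) x" using that by (intro \<gamma>(2)) auto
    also have "\<dots> < \<gamma>" using that(3,4) by (metis dist_commute dist_triangle_half_r)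
    finally show False by simp
  qed
  show thesis
  proof (rule that[of "\<gamma> / 2"])
    fix \<eta> :: real assume "0 < \<eta>"
    then obtain N where N: "\<And>x y A B. \<lbrakk>x \<in> X; y \<in> X; N \<le> A; shadows c \<delta> A B x y\<rbrakk>
      \<Longrightarrow> \<exists>\<tau>\<in>{0..T}. dist y (\<phi> (x, \<tau>)) < min \<eta> (\<gamma> / 2) \<or> dist x (\<phi> (y, \<tau>)) < min \<eta> (\<gamma> / 2)"
      using shadows_imp_near[OF assms(1), of "min \<eta> (\<gamma> / 2)"] \<gamma>(1) by (metis half_gt_zero min_less_iff_conj)
    have "\<exists>\<tau>\<in>{0..<e}. dist y (\<phi> (x, \<tau>)) < \<eta> \<or> dist x (\<phi> (y, \<tau>)) < \<eta>"
      if "x \<in> X" "y \<in> X" "N \<le> A" "shadows c \<delta> A B x y" "dist x y < \<gamma> / 2" for x y A B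
      using N[OF that(1-4)] small[of x y] small[of y x] that by (auto simp: dist_commute)
    then show "\<exists>N. \<forall>x\<in>X. \<forall>y\<in>X. \<forall>A\<ge>N. \<forall>B. shadows c \<delta> A B x y \<and> dist x y < \<gamma> / 2 \<longrightarrow>
      (\<exists>\<tau>\<in>{0..<e}. dist y (\<phi> (x, \<tau>)) < \<eta> \<or> dist x (\<phi> (y, \<tau>)) < \<eta>)" by blast
  qed (use \<gamma> in auto)
qed

text \<open>A continuous injective map on a compact space has a uniformly continuous inverse.
  Closeness at time \<open>u\<close> is carried forward to \<open>M\<close>, pulled back to time 0
  and carried forward to \<open>t\<close>; hence \<open>t\<close> may be earlier than
  \<open>u\<close>.\<close>

lemma flow_inverse_uniform:
  assumes "0 < e" "0 \<le> M"
  obtains \<eta> where "0 < \<eta>"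
    "\<And>x y t u. \<lbrakk>x \<in> X; y \<in> X; t \<in> {0..M}; u \<in> {0..M}; dist (\<phi> (x, u)) (\<phi> (y, u)) < \<eta>\<rbrakk>
      \<Longrightarrow> dist (\<phi> (x, t)) (\<phi> (y, t)) < e"
proof -
  obtain d where d: "0 < d"
    "\<And>x y t u. \<lbrakk>x \<in> X; y \<in> X; t \<in> {0..M}; u \<in> {0..M}; dist x y < d; \<bar>t - u\<bar> < d\<rbrakk>
      \<Longrightarrow> dist (\<phi> (x, t)) (\<phi> (y, u)) < e"
    using flow_uniform[OF assms(1)] by metis
  define C where "C = (X \<times> X) \<inter> {z. d \<le> dist (fst z) (snd z)}"
  have "compact C"
    unfolding C_def using compact_X
    by (intro compact_Int_closed compact_Times closed_Collect_le continuous_intros)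
  obtain e' where e': "0 < e'"
    "\<And>x y. \<lbrakk>x \<in> X; y \<in> X; dist (\<phi> (x, M)) (\<phi> (y, M)) < e'\<rbrakk> \<Longrightarrow> dist x y < d"
  proof (cases "C = {}")
    case True
    then have "dist x y < d" if "x \<in> X" "y \<in> X" for x y using that by (force simp: C_def)
    then show thesis using that[of 1] by auto
  next
    case False
    have "continuous_on C (\<lambda>z. dist (\<phi> (fst z, M)) (\<phi> (snd z, M)))"
      using assms(2) by (intro continuous_intros) (auto simp: C_def)
    then obtain z where z: "z \<in> C" "\<And>z'. z' \<in> C \<Longrightarrow>
        dist (\<phi> (fst z, M)) (\<phi> (snd z, M)) \<le> dist (\<phi> (fst z', M)) (\<phi> (snd z', M))"
      using continuous_attains_inf[OF \<open>compact C\<close> False] by blast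
    have zX: "fst z \<in> X" "snd z \<in> X" "fst z \<noteq> snd z" using z(1) d(1) by (auto simp: C_def)
    then have "\<phi> (fst z, M) \<noteq> \<phi> (snd z, M)" using flow_inj assms(2) by blast
    moreover have "dist x y < d"
      if "x \<in> X" "y \<in> X" "dist (\<phi> (x, M)) (\<phi> (y, M)) < dist (\<phi> (fst z, M)) (\<phi> (snd z, M))" for x y
      using z(2)[of "(x, y)"] that by (force simp: C_def)
    ultimately show thesis by (intro that[of "dist (\<phi> (fst z, M)) (\<phi> (snd z, M))"]) auto
  qed
  obtain \<eta> where \<eta>: "0 < \<eta>"
    "\<And>x y t u. \<lbrakk>x \<in> X; y \<in> X; t \<in> {0..M}; u \<in> {0..M}; dist x y < \<eta>; \<bar>t - u\<bar> < \<eta>\<rbrakk>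
      \<Longrightarrow> dist (\<phi> (x, t)) (\<phi> (y, u)) < e'"
    using flow_uniform[OF e'(1)] by metis
  show thesis
  proof (rule that[OF \<eta>(1)])
    fix x y t u
    assume *: "x \<in> X" "y \<in> X" "t \<in> {0..M}" "u \<in> {0..M}" "dist (\<phi> (x, u)) (\<phi> (y, u)) < \<eta>"
    have "dist (\<phi> (\<phi> (x, u), M - u)) (\<phi> (\<phi> (y, u), M - u)) < e'"
      using * \<eta>(1) by (intro \<eta>(2)) auto
    then have "dist x y < d" using * e'(2) by (simp add: flow_add)
    then show "dist (\<phi> (x, t)) (\<phi> (y, t)) < e" using * d by auto
  qed
qed

text \<open>Closeness \<eta> at the old start gives only coarse closeness one unit earlier. The long
  shadowing that follows improves it: by \<open>shadows_imp_near_small_shift\<close> a small change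
  of \<open>b\<close> brings the new starting points within \<open>e\<close>. Here \<eta> is fixed
  and only \<open>N\<close> depends on \<open>e\<close>, so the choice \<open>e = \<eta>\<close>
  lets the extension be repeated.\<close>

lemma extend_shadowing_back:
  obtains \<eta> where "0 < \<eta>"
    "\<And>e. 0 < e \<Longrightarrow> \<exists>N. \<forall>x\<in>X. \<forall>y\<in>X. \<forall>b\<ge>1/2. \<forall>A\<ge>N. \<forall>B.
      0 \<le> A \<and> dist (\<phi> (x, 1)) (\<phi> (y, b + 1)) < \<eta> \<and>
      shadows 2 (\<delta> / 2) A B (\<phi> (x, 1)) (\<phi> (y, b + 1)) \<longrightarrow>
      (\<exists>b'. \<bar>b' - b\<bar> \<le> 1/2 \<and> dist x (\<phi> (y, b')) < e \<and>
        shadows 2 (\<delta> / 2) (1 + A) (b + 1 - b' + B) x (\<phi> (y, b')))"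
proof -
  obtain h where h: "0 < h"
    "\<And>x t u. \<lbrakk>x \<in> X; 0 \<le> t; 0 \<le> u; \<bar>t - u\<bar> \<le> h\<rbrakk> \<Longrightarrow> dist (\<phi> (x, t)) (\<phi> (x, u)) < \<delta> / 4"
    using small_time_displacement[of "\<delta> / 4"] \<delta>_pos by auto
  \<comment> \<open>Shifts up to \<open>h\<close> move points by less than \<delta>/4; shifts up to
    1/2 keep the rate of the new unit of time within 2.\<close>
  define \<epsilon> where "\<epsilon> = min h (1/2)"
  have \<epsilon>: "0 < \<epsilon>" "\<epsilon> \<le> h" "\<epsilon> \<le> 1/2" using h(1) by (auto simp: \<epsilon>_def)
  obtain \<gamma> where \<gamma>: "0 < \<gamma>"
    "\<And>\<eta>. 0 < \<eta> \<Longrightarrow> \<exists>N. \<forall>x\<in>X. \<forall>y\<in>X. \<forall>A\<ge>N. \<forall>B. shadows 2 \<delta> A B x y \<and> dist x y < \<gamma> \<longrightarrow>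
      (\<exists>\<tau>\<in>{0..<\<epsilon>}. dist y (\<phi> (x, \<tau>)) < \<eta> \<or> dist x (\<phi> (y, \<tau>)) < \<eta>)"
    using shadows_imp_near_small_shift[OF _ \<epsilon>(1), of 2] by (metis zero_less_numeral)
  define \<beta> where "\<beta> = min (\<delta> / 4) \<gamma>"
  have \<beta>: "0 < \<beta>" "\<beta> \<le> \<delta> / 4" "\<beta> \<le> \<gamma>" using \<gamma>(1) \<delta>_pos by (auto simp: \<beta>_def)
  obtain \<eta> where \<eta>: "0 < \<eta>"
    "\<And>x y t u. \<lbrakk>x \<in> X; y \<in> X; t \<in> {0..1}; u \<in> {0..1}; dist (\<phi> (x, u)) (\<phi> (y, u)) < \<eta>\<rbrakk>
      \<Longrightarrow> dist (\<phi> (x, t)) (\<phi> (y, t)) < \<beta>"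
    using flow_inverse_uniform[OF \<beta>(1), of 1] by (metis zero_le_one)
  show thesis
  proof (rule that[OF \<eta>(1)])
    fix e :: real assume e: "0 < e"
    obtain \<eta>' where \<eta>': "0 < \<eta>'"
      "\<And>x y t u. \<lbrakk>x \<in> X; y \<in> X; t \<in> {0..1}; u \<in> {0..1}; dist (\<phi> (x, u)) (\<phi> (y, u)) < \<eta>'\<rbrakk>
        \<Longrightarrow> dist (\<phi> (x, t)) (\<phi> (y, t)) < e"
      using flow_inverse_uniform[OF e, of 1] by (metis zero_le_one)
    obtain N where N: "\<And>x y A B. \<lbrakk>x \<in> X; y \<in> X; N \<le> A; shadows 2 \<delta> A B x y; dist x y < \<gamma>\<rbrakk> \<Longrightarrow>
      \<exists>\<tau>\<in>{0..<\<epsilon>}. dist y (\<phi> (x, \<tau>)) < min e \<eta>' \<or> dist x (\<phi> (y, \<tau>)) < min e \<eta>'"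
      using \<gamma>(2)[of "min e \<eta>'"] e \<eta>'(1) by fastforce
    have "\<exists>b'. \<bar>b' - b\<bar> \<le> 1/2 \<and> dist x (\<phi> (y, b')) < e \<and>
        shadows 2 (\<delta> / 2) (1 + A) (b + 1 - b' + B) x (\<phi> (y, b'))"
      if x: "x \<in> X" and y: "y \<in> X" and b: "1/2 \<le> b" and A: "N \<le> A" "0 \<le> A"
        and close: "dist (\<phi> (x, 1)) (\<phi> (y, b + 1)) < \<eta>"
        and sh: "shadows 2 (\<delta> / 2) A B (\<phi> (x, 1)) (\<phi> (y, b + 1))" for x y b A B
    proof -
      define y' where "y' = \<phi> (y, b)"
      have y': "y' \<in> X" "\<And>t. 0 \<le> t \<Longrightarrow> \<phi> (y', t) = \<phi> (y, b + t)"
        using y b by (auto simp: y'_def flow_add)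
      have near: "dist (\<phi> (x, t)) (\<phi> (y', t)) < \<beta>" if "t \<in> {0..1}" for t
        using \<eta>(2)[OF x y'(1) that, of 1] close y'(2)[of 1] by simp
      have "shadows 2 (\<delta> / 2) 1 1 x y'"
        using near \<beta>(2) \<delta>_pos by (intro shadows_linear) (fastforce intro: less_imp_le)+
      then have "shadows 2 (\<delta> / 2) (1 + A) (1 + B) x y'"
        using sh x y' A by (intro shadows_concat) auto
      then have "shadows 2 \<delta> (1 + A) (1 + B) x y'"
        using \<delta>_pos by (elim shadows_mono) auto
      moreover have "dist x y' < \<gamma>" using near[of 0] \<beta>(3) x y' by simp
      ultimately obtain \<tau> where \<tau>: "0 \<le> \<tau>" "\<tau> < \<epsilon>"
        "dist y' (\<phi> (x, \<tau>)) < min e \<eta>' \<or> dist x (\<phi> (y', \<tau>)) < min e \<eta>'"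
        using N[OF x y'(1), of "1 + A" "1 + B"] A by auto
      obtain b' where b': "\<bar>b' - b\<bar> \<le> \<epsilon>" "dist x (\<phi> (y, b')) < e"
        using \<tau>(3)
      proof
        \<comment> \<open>Here \<open>x\<close> would have to move forward. Instead
          \<open>y'\<close> is moved back by \<tau>, for which \<open>1/2 \<le> b\<close> leaves
          room, and \<eta>' turns closeness at time \<tau> into closeness at time 0.\<close>
        assume "dist y' (\<phi> (x, \<tau>)) < min e \<eta>'"
        then have "dist (\<phi> (x, \<tau>)) (\<phi> (\<phi> (y, b - \<tau>), \<tau>)) < \<eta>'"
          using y b \<tau> \<epsilon> by (simp add: flow_add y'_def dist_commute)
        then have "dist (\<phi> (x, 0)) (\<phi> (\<phi> (y, b - \<tau>), 0)) < e"
          using x y b \<tau> \<epsilon> by (intro \<eta>'(2)) auto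
        then show thesis using that[of "b - \<tau>"] x y b \<tau> \<epsilon> by simp
      next
        assume "dist x (\<phi> (y', \<tau>)) < min e \<eta>'"
        then show thesis using that[of "b + \<tau>"] y'(2) \<tau> by simp
      qed
      have b'0: "0 \<le> b'" "\<bar>b' - b\<bar> \<le> 1/2" using b' b \<epsilon> by auto
      have len: "0 \<le> b + 1 - b'" using b'0(2) by linarith
      \<comment> \<open>The first unit of \<open>x\<close> is mapped linearly onto the times from
        \<open>b'\<close> to \<open>b + 1\<close>, a stretch of length between 1/2 and 3/2. The
        error is at most \<delta>/4 for the distance to the orbit of \<open>y'\<close> plus
        \<delta>/4 for the change of time. As the end is still at \<open>b + 1\<close>, the given
        shadowing can be attached unchanged.\<close>
      have "shadows 2 (\<delta> / 2) 1 (b + 1 - b') x (\<phi> (y, b'))"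
      proof (rule shadows_linear)
        fix u :: real assume u: "u \<in> {0..1}"
        have "\<bar>(b' - b) * (1 - u)\<bar> \<le> \<bar>b' - b\<bar>" using u by (simp add: abs_mult mult_left_le)
        moreover have "b' + u * (b + 1 - b') - (b + u) = (b' - b) * (1 - u)" by (simp add: algebra_simps)
        ultimately have "\<bar>b' + u * (b + 1 - b') - (b + u)\<bar> \<le> h" using b'(1) \<epsilon>(2) by linarith
        moreover have "0 \<le> u * (b + 1 - b')" using u len by simp
        ultimately have "dist (\<phi> (\<phi> (y, b'), u * (b + 1 - b'))) (\<phi> (y', u)) < \<delta> / 4"
          using h(2)[of y "b' + u * (b + 1 - b')" "b + u"] y y'(2) u b b'0 by (simp add: flow_add)
        moreover have "dist (\<phi> (x, u)) (\<phi> (y', u)) < \<delta> / 4" using near[OF u] \<beta>(2) by simp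
        ultimately show "dist (\<phi> (x, u * 1)) (\<phi> (\<phi> (y, b'), u * (b + 1 - b'))) \<le> \<delta> / 2"
          using dist_triangle2[of "\<phi> (x, u)" "\<phi> (\<phi> (y, b'), u * (b + 1 - b'))" "\<phi> (y', u)"] by simp
      qed (use b'0(2) in linarith)+
      then have "shadows 2 (\<delta> / 2) (1 + A) (b + 1 - b' + B) x (\<phi> (y, b'))"
        using sh x y A b'0 len by (intro shadows_concat) (simp_all add: flow_add)
      then show ?thesis using b'(2) b'0(2) by blast
    qed
    then show "\<exists>N. \<forall>x\<in>X. \<forall>y\<in>X. \<forall>b\<ge>1/2. \<forall>A\<ge>N. \<forall>B.
      0 \<le> A \<and> dist (\<phi> (x, 1)) (\<phi> (y, b + 1)) < \<eta> \<and>
      shadows 2 (\<delta> / 2) A B (\<phi> (x, 1)) (\<phi> (y, b + 1)) \<longrightarrow>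
      (\<exists>b'. \<bar>b' - b\<bar> \<le> 1/2 \<and> dist x (\<phi> (y, b')) < e \<and>
        shadows 2 (\<delta> / 2) (1 + A) (b + 1 - b' + B) x (\<phi> (y, b')))"
      by blast
  qed
qed

text \<open>The past is contracting: \<eta> is fixed, whereas \<open>e\<close> may be as small as
  desired once \<open>n\<close> is large. The induction restores closeness at the start with every
  unit of time added; only the final extension asks for \<open>e\<close>.\<close>

lemma backward_shadowing:
  obtains \<eta> where "0 < \<eta>"
    "\<And>e. 0 < e \<Longrightarrow> \<exists>n\<^sub>0. \<forall>n\<ge>n\<^sub>0. \<forall>x\<in>X. \<forall>y\<in>X. \<forall>b.
      dist (\<phi> (x, real n)) (\<phi> (y, b)) < \<eta> \<and> 2 * real n + 2 \<le> b \<longrightarrow>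
      (\<exists>b'. 0 \<le> b' \<and> b' \<le> b \<and> dist x (\<phi> (y, b')) < e \<and>
        shadows 2 (\<delta> / 2) (real n) (b - b') x (\<phi> (y, b')))"
proof -
  obtain \<eta> where \<eta>: "0 < \<eta>"
    "\<And>e. 0 < e \<Longrightarrow> \<exists>N. \<forall>x\<in>X. \<forall>y\<in>X. \<forall>b\<ge>1/2. \<forall>A\<ge>N. \<forall>B.
      0 \<le> A \<and> dist (\<phi> (x, 1)) (\<phi> (y, b + 1)) < \<eta> \<and>
      shadows 2 (\<delta> / 2) A B (\<phi> (x, 1)) (\<phi> (y, b + 1)) \<longrightarrow>
      (\<exists>b'. \<bar>b' - b\<bar> \<le> 1/2 \<and> dist x (\<phi> (y, b')) < e \<and>
        shadows 2 (\<delta> / 2) (1 + A) (b + 1 - b' + B) x (\<phi> (y, b')))"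
    using extend_shadowing_back by metis
  \<comment> \<open>Each unit backwards costs at most 3/2 of time along the orbit of
    \<open>y\<close>. The bound \<open>b - 2 * real n \<le> b'\<close> together with
    \<open>2 * real n + 2 \<le> b\<close> therefore keeps enough room above time 0 for the next
    extension.\<close>
  define traced where "traced e n x y b \<longleftrightarrow> (\<exists>b'. 0 \<le> b' \<and> b - 2 * real n \<le> b' \<and> b' \<le> b \<and>
    dist x (\<phi> (y, b')) < e \<and> shadows 2 (\<delta> / 2) (real n) (b - b') x (\<phi> (y, b')))" for e n x y b
  have step: "\<exists>N. \<forall>n\<ge>N. \<forall>x\<in>X. \<forall>y\<in>X. \<forall>b.
      2 * real (Suc n) + 2 \<le> b \<and> traced \<eta> n (\<phi> (x, 1)) y b \<longrightarrow> traced e (Suc n) x y b" if e: "0 < e" for e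
  proof -
    obtain N where N: "\<And>x y b A B. \<lbrakk>x \<in> X; y \<in> X; 1/2 \<le> b; N \<le> A; 0 \<le> A;
        dist (\<phi> (x, 1)) (\<phi> (y, b + 1)) < \<eta>; shadows 2 (\<delta> / 2) A B (\<phi> (x, 1)) (\<phi> (y, b + 1))\<rbrakk> \<Longrightarrow>
      \<exists>b'. \<bar>b' - b\<bar> \<le> 1/2 \<and> dist x (\<phi> (y, b')) < e \<and>
        shadows 2 (\<delta> / 2) (1 + A) (b + 1 - b' + B) x (\<phi> (y, b'))"
      using \<eta>(2)[OF e] by blast
    have "traced e (Suc n) x y b"
      if n: "nat \<lceil>N\<rceil> \<le> n" and x: "x \<in> X" and y: "y \<in> X" and b: "2 * real (Suc n) + 2 \<le> b"
        and tr: "traced \<eta> n (\<phi> (x, 1)) y b" for n x y b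
    proof -
      obtain c where c: "b - 2 * real n \<le> c" "c \<le> b" "dist (\<phi> (x, 1)) (\<phi> (y, c)) < \<eta>"
        "shadows 2 (\<delta> / 2) (real n) (b - c) (\<phi> (x, 1)) (\<phi> (y, c))"
        using tr by (auto simp: traced_def)
      have "N \<le> real n" using n by linarith
      moreover have "1/2 \<le> c - 1" using b c(1) by simp
      ultimately obtain b' where b': "\<bar>b' - (c - 1)\<bar> \<le> 1/2" "dist x (\<phi> (y, b')) < e"
        "shadows 2 (\<delta> / 2) (1 + real n) (c - 1 + 1 - b' + (b - c)) x (\<phi> (y, b'))"
        using N[of x y "c - 1" "real n" "b - c"] x y c(3,4) by auto
      have "c - 1 + 1 - b' + (b - c) = b - b'" "1 + real n = real (Suc n)" by auto
      with b'(3) have "shadows 2 (\<delta> / 2) (real (Suc n)) (b - b') x (\<phi> (y, b'))" by (simp only:)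
      moreover have "c - 3/2 \<le> b'" "b' \<le> c - 1/2" using b'(1) by (simp_all only: abs_le_iff) argo+
      then have "0 \<le> b'" "b - 2 * real (Suc n) \<le> b'" "b' \<le> b" using c(1,2) b by auto
      ultimately show ?thesis unfolding traced_def using b'(2) by blast
    qed
    then show ?thesis by blast
  qed
  obtain N where N: "\<And>n x y b. \<lbrakk>N \<le> n; x \<in> X; y \<in> X; 2 * real (Suc n) + 2 \<le> b; traced \<eta> n (\<phi> (x, 1)) y b\<rbrakk>
      \<Longrightarrow> traced \<eta> (Suc n) x y b"
    using step[OF \<eta>(1)] by blast
  \<comment> \<open>Extensions work only from length \<open>N\<close> on, so the first
    \<open>M\<close> units come from \<open>flow_inverse_uniform\<close> instead. The successor
    makes this length positive, as \<open>shadows_linear\<close> requires.\<close>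
  define M where "M = Suc N"
  obtain \<eta>\<^sub>0 where \<eta>0: "0 < \<eta>\<^sub>0"
    "\<And>x y t u. \<lbrakk>x \<in> X; y \<in> X; t \<in> {0..real M}; u \<in> {0..real M}; dist (\<phi> (x, u)) (\<phi> (y, u)) < \<eta>\<^sub>0\<rbrakk>
      \<Longrightarrow> dist (\<phi> (x, t)) (\<phi> (y, t)) < min \<eta> (\<delta> / 2)"
    using flow_inverse_uniform[of "min \<eta> (\<delta> / 2)" "real M"] \<eta>(1) \<delta>_pos by (metis half_gt_zero min_less_iff_conj of_nat_0_le_iff)
  have all: "\<forall>x\<in>X. \<forall>y\<in>X. \<forall>b. dist (\<phi> (x, real n)) (\<phi> (y, b)) < \<eta>\<^sub>0 \<and> 2 * real n + 2 \<le> b \<longrightarrow> traced \<eta> n x y b"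
    if "M \<le> n" for n
    using that
  proof (induction n rule: dec_induct)
    case base
    show ?case
    proof (intro ballI allI impI)
      fix x y b assume x: "x \<in> X" and y: "y \<in> X"
        and *: "dist (\<phi> (x, real M)) (\<phi> (y, b)) < \<eta>\<^sub>0 \<and> 2 * real M + 2 \<le> b"
      define y' where "y' = \<phi> (y, b - real M)"
      have y': "y' \<in> X" "\<phi> (y', real M) = \<phi> (y, b)" using y * by (auto simp: y'_def flow_add)
      have near: "dist (\<phi> (x, t)) (\<phi> (y', t)) < min \<eta> (\<delta> / 2)" if "t \<in> {0..real M}" for t
        using \<eta>0(2)[OF x y'(1) that, of "real M"] * y'(2) by auto
      have "shadows 2 (\<delta> / 2) (real M) (b - (b - real M)) x y'"
      proof (rule shadows_linear)
        fix u :: real assume u: "u \<in> {0..1}"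
        then have "u * real M \<le> real M" by (simp add: mult_left_le_one_le)
        then show "dist (\<phi> (x, u * real M)) (\<phi> (y', u * (b - (b - real M)))) \<le> \<delta> / 2"
          using near[of "u * real M"] u by auto
      qed (auto simp: M_def)
      moreover have "dist x y' < \<eta>" using near[of 0] x y'(1) by simp
      ultimately show "traced \<eta> M x y b" unfolding traced_def y'_def using *
        by (intro exI[of _ "b - real M"]) auto
    qed
  next
    case (step n)
    show ?case
    proof (intro ballI allI impI)
      fix x y b assume x: "x \<in> X" and y: "y \<in> X"
        and *: "dist (\<phi> (x, real (Suc n))) (\<phi> (y, b)) < \<eta>\<^sub>0 \<and> 2 * real (Suc n) + 2 \<le> b"
      then have "dist (\<phi> (\<phi> (x, 1), real n)) (\<phi> (y, b)) < \<eta>\<^sub>0" by (simp add: flow_add)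
      then have "traced \<eta> n (\<phi> (x, 1)) y b" using step.IH x y * by auto
      then show "traced \<eta> (Suc n) x y b" using N x y * step.hyps by (auto simp: M_def)
    qed
  qed
  show thesis
  proof (rule that[OF \<eta>0(1)])
    fix e :: real assume "0 < e"
    then obtain N' where N': "\<And>n x y b. \<lbrakk>N' \<le> n; x \<in> X; y \<in> X; 2 * real (Suc n) + 2 \<le> b;
        traced \<eta> n (\<phi> (x, 1)) y b\<rbrakk> \<Longrightarrow> traced e (Suc n) x y b"
      using step by blast
    have "traced e n x y b" if n: "Suc (max M N') \<le> n" and x: "x \<in> X" and y: "y \<in> X"
      and *: "dist (\<phi> (x, real n)) (\<phi> (y, b)) < \<eta>\<^sub>0" "2 * real n + 2 \<le> b" for n x y b
    proof -
      obtain k where k: "n = Suc k" "M \<le> k" "N' \<le> k" using n by (cases n) auto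
      have "dist (\<phi> (\<phi> (x, 1), real k)) (\<phi> (y, b)) < \<eta>\<^sub>0" using * k x by (simp add: flow_add)
      then have "traced \<eta> k (\<phi> (x, 1)) y b" using all[OF k(2)] x y * k by auto
      then show ?thesis using N' k x y * by auto
    qed
    then show "\<exists>n\<^sub>0. \<forall>n\<ge>n\<^sub>0. \<forall>x\<in>X. \<forall>y\<in>X. \<forall>b.
      dist (\<phi> (x, real n)) (\<phi> (y, b)) < \<eta>\<^sub>0 \<and> 2 * real n + 2 \<le> b \<longrightarrow>
      (\<exists>b'. 0 \<le> b' \<and> b' \<le> b \<and> dist x (\<phi> (y, b')) < e \<and>
        shadows 2 (\<delta> / 2) (real n) (b - b') x (\<phi> (y, b')))"
      unfolding traced_def by blast
  qed
qed

text \<open>It matters that one \<open>k\<close> serves all sequences: in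
  \<open>all_points_periodic\<close> the sequence depends on the desired accuracy of the return, but
  the bound on the length of the loop must not.\<close>

lemma pigeonhole_close:
  assumes "0 < e"
  obtains k where "\<And>f::nat \<Rightarrow> 'a. (\<And>i. f i \<in> X) \<Longrightarrow> \<exists>i j. i < j \<and> j \<le> k \<and> dist (f i) (f j) < e"
proof -
  obtain C where C: "finite C" "X \<subseteq> (\<Union>c\<in>C. ball c (e / 2))"
    using compact_X assms unfolding compact_eq_totally_bounded by (meson half_gt_zero)
  show thesis
  proof (rule that[of "card C"])
    fix f :: "nat \<Rightarrow> 'a" assume "\<And>i. f i \<in> X"
    then have "\<forall>i. \<exists>c\<in>C. dist c (f i) < e / 2" using C(2) by fastforce
    then obtain g where g: "\<And>i. g i \<in> C" "\<And>i. dist (g i) (f i) < e / 2" by metis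
    have "card (g ` {..card C}) \<le> card C" using g(1) C(1) by (intro card_mono) auto
    then have "\<not> inj_on g {..card C}" using pigeonhole[of g "{..card C}"] by simp
    then obtain i j where ij: "i \<le> card C" "j \<le> card C" "i < j" "g i = g j"
      unfolding inj_on_def by (metis atMost_iff nat_neq_iff)
    then have "dist (f i) (f j) < e" using g(2) by (metis dist_triangle_half_r)
    then show "\<exists>i j. i < j \<and> j \<le> card C \<and> dist (f i) (f j) < e" using ij by blast
  qed
qed

section \<open>Periodicity\<close>

text \<open>
  Near the end of a long orbit segment of \<open>x\<close>, pigeonhole gives a piece of bounded length, from
  \<open>x\<^sub>0\<close> on, whose end points are close. Backward shadowing follows this piece over and over, each
  time ending near its start. Consecutive passes shadow each other, so in the limit the orbit of
  the initial point shadows a translate of itself by a time that is at least \<open>1\<close>. Shadowing the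
  same piece each time keeps the time between passes bounded.
\<close>

lemma all_points_periodic:
  assumes x: "x \<in> X"
  obtains P where "0 < P" "\<phi> (x, P) = x"
proof -
  obtain \<eta> where \<eta>: "0 < \<eta>"
    "\<And>e. 0 < e \<Longrightarrow> \<exists>n\<^sub>0. \<forall>n\<ge>n\<^sub>0. \<forall>x\<in>X. \<forall>y\<in>X. \<forall>b.
      dist (\<phi> (x, real n)) (\<phi> (y, b)) < \<eta> \<and> 2 * real n + 2 \<le> b \<longrightarrow>
      (\<exists>b'. 0 \<le> b' \<and> b' \<le> b \<and> dist x (\<phi> (y, b')) < e \<and>
        shadows 2 (\<delta> / 2) (real n) (b - b') x (\<phi> (y, b')))"
    using backward_shadowing by metis
  obtain n\<^sub>0 where n0: "\<And>n x y b. \<lbrakk>n\<^sub>0 \<le> n; x \<in> X; y \<in> X;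
      dist (\<phi> (x, real n)) (\<phi> (y, b)) < \<eta>; 2 * real n + 2 \<le> b\<rbrakk> \<Longrightarrow>
      \<exists>b'. 0 \<le> b' \<and> b' \<le> b \<and> dist x (\<phi> (y, b')) < \<eta> / 2 \<and>
        shadows 2 (\<delta> / 2) (real n) (b - b') x (\<phi> (y, b'))"
    using \<eta>(2)[of "\<eta> / 2"] \<eta>(1) by fastforce
  \<comment> \<open>A pass is shortened at most by the factor 2, so it still lasts at least
    \<open>T + 1\<close>. After a final shift of at most \<open>T\<close>, a time difference of at
    least 1 remains.\<close>
  define m where "m = max n\<^sub>0 (nat \<lceil>2 * T + 2\<rceil>)"
  have m: "n\<^sub>0 \<le> m" "2 * T + 2 \<le> real m" by (auto simp: m_def) linarith
  obtain k where k: "\<And>f::nat \<Rightarrow> 'a. (\<And>i. f i \<in> X) \<Longrightarrow> \<exists>i j. i < j \<and> j \<le> k \<and> dist (f i) (f j) < \<eta> / 2"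
    using pigeonhole_close[of "\<eta> / 2"] \<eta>(1) by (metis half_gt_zero)
  \<comment> \<open>The last pass satisfies \<open>r' < 2 * real n + 2\<close> and
    \<open>r - r' \<le> 2 * real n\<close> with \<open>n \<le> k * m\<close>, so
    \<open>r \<le> D\<close>. This bound does not depend on the accuracy \<open>e\<close>.\<close>
  define D where "D = 4 * real (k * m) + 4"
  have D0: "0 \<le> D" by (simp add: D_def)
  have almost: "\<exists>u v. 0 \<le> u \<and> u + 1 \<le> v \<and> v \<le> D + T \<and> dist (\<phi> (x, u)) (\<phi> (x, v)) < e" if e: "0 < e" for e
  proof -
    obtain N where N: "0 \<le> N" "\<And>x y A B. \<lbrakk>x \<in> X; y \<in> X; N \<le> A; shadows 4 \<delta> A B x y\<rbrakk>
      \<Longrightarrow> \<exists>\<tau>\<in>{0..T}. dist y (\<phi> (x, \<tau>)) < e \<or> dist x (\<phi> (y, \<tau>)) < e"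
      using shadows_imp_near[of 4 e] e by (metis zero_less_numeral)
    have "0 \<le> N + D + real i * real m" for i using N(1) D0 by simp
    then obtain i j where ij: "i < j" "j \<le> k"
      "dist (\<phi> (x, N + D + real i * real m)) (\<phi> (x, N + D + real j * real m)) < \<eta> / 2"
      using k[of "\<lambda>i. \<phi> (x, N + D + real i * real m)"] x by auto
    \<comment> \<open>The offset \<open>N + D\<close> ensures \<open>N \<le> p - r\<close> for every
      \<open>r \<le> D\<close>: the last pass is then followed by a shadowing long enough for
      \<open>shadows_imp_near\<close>.\<close>
    define p where "p = N + D + real i * real m"
    define n where "n = (j - i) * m"
    define x\<^sub>0 where "x\<^sub>0 = \<phi> (x, p)"
    have p: "N + D \<le> p" "0 \<le> p" using N(1) D0 by (auto simp: p_def)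
    have "m \<le> n" "n \<le> k * m" using ij by (auto simp: n_def)
    then have n: "n\<^sub>0 \<le> n" "2 * T + 2 \<le> real n" "4 * real n + 4 \<le> D" "0 \<le> real n"
      using m unfolding D_def of_nat_mult[symmetric] by linarith+
    have x0: "x\<^sub>0 \<in> X" using x p by (simp add: x\<^sub>0_def)
    have "real n = real j * real m - real i * real m" using ij(1) by (simp add: n_def of_nat_diff algebra_simps)
    then have "p + real n = N + D + real j * real m" by (simp add: p_def)
    then have "\<phi> (x\<^sub>0, real n) = \<phi> (x, N + D + real j * real m)"
      using x p(2) by (simp add: x\<^sub>0_def flow_add)
    then have loop: "dist x\<^sub>0 (\<phi> (x\<^sub>0, real n)) < \<eta> / 2"
      using ij(3) by (simp add: x\<^sub>0_def p_def)
    have go: "\<exists>r'. 0 \<le> r' \<and> real n / 2 \<le> r - r' \<and> dist x\<^sub>0 (\<phi> (x, r')) < \<eta> / 2 \<and>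
        shadows 2 (\<delta> / 2) (real n) (r - r') x\<^sub>0 (\<phi> (x, r'))"
      if close: "dist x\<^sub>0 (\<phi> (x, r)) < \<eta> / 2" and late: "2 * real n + 2 \<le> r" for r
    proof -
      have "dist (\<phi> (x\<^sub>0, real n)) (\<phi> (x, r)) < \<eta>" using loop close by (rule dist_triangle_half_r)
      then obtain r' where "0 \<le> r'" "dist x\<^sub>0 (\<phi> (x, r')) < \<eta> / 2"
        "shadows 2 (\<delta> / 2) (real n) (r - r') x\<^sub>0 (\<phi> (x, r'))"
        using n0[OF n(1) x0 x] late by blast
      then show ?thesis using shadows_length(1) n(4) by blast
    qed
    \<comment> \<open>The last clause says that the whole stretch from \<open>r\<close> to
      \<open>p\<close> is shadowed from \<open>r'\<close> on. To extend it, the times from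
      \<open>r'\<close> to \<open>r\<close> are matched with those from \<open>r''\<close> to
      \<open>r'\<close> through the common piece at \<open>x\<^sub>0\<close>, and the result is
      glued in front. At most two reparametrizations are ever composed.\<close>
    define pass where "pass r r' \<longleftrightarrow> 0 \<le> r' \<and> real n / 2 \<le> r - r' \<and> r \<le> p \<and> dist x\<^sub>0 (\<phi> (x, r')) < \<eta> / 2 \<and>
      shadows 2 (\<delta> / 2) (real n) (r - r') x\<^sub>0 (\<phi> (x, r')) \<and>
      (\<exists>B. shadows 4 \<delta> (p - r) B (\<phi> (x, r)) (\<phi> (x, r')))" for r r'
    have first_pass: "\<exists>r'. pass p r'"
    proof -
      have "dist x\<^sub>0 (\<phi> (x, p)) < \<eta> / 2" "2 * real n + 2 \<le> p" using \<eta>(1) n p N(1) by (auto simp: x\<^sub>0_def)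
      then obtain r' where r': "0 \<le> r'" "real n / 2 \<le> p - r'" "dist x\<^sub>0 (\<phi> (x, r')) < \<eta> / 2"
        "shadows 2 (\<delta> / 2) (real n) (p - r') x\<^sub>0 (\<phi> (x, r'))"
        using go by blast
      have "dist x\<^sub>0 (\<phi> (x, r')) \<le> \<delta> / 2" using shadows_0[OF r'(4)] n x x0 r'(1) by simp
      then have "shadows 4 \<delta> 0 0 x\<^sub>0 (\<phi> (x, r'))"
        using x x0 r'(1) \<delta>_pos by (intro shadows_trivial) auto
      then show ?thesis using r' unfolding pass_def x\<^sub>0_def by auto
    qed
    have next_pass: "\<exists>r''. pass r' r''" if pass: "pass r r'" and late: "2 * real n + 2 \<le> r'" for r r'
    proof -
      obtain B where r: "0 \<le> r'" "real n / 2 \<le> r - r'" "r \<le> p" "dist x\<^sub>0 (\<phi> (x, r')) < \<eta> / 2"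
        "shadows 2 (\<delta> / 2) (real n) (r - r') x\<^sub>0 (\<phi> (x, r'))"
        "shadows 4 \<delta> (p - r) B (\<phi> (x, r)) (\<phi> (x, r'))"
        using pass unfolding pass_def by blast
      obtain r'' where r'': "0 \<le> r''" "real n / 2 \<le> r' - r''" "dist x\<^sub>0 (\<phi> (x, r'')) < \<eta> / 2"
        "shadows 2 (\<delta> / 2) (real n) (r' - r'') x\<^sub>0 (\<phi> (x, r''))"
        using go[OF r(4) late] by blast
      have le: "r' \<le> r" "r'' \<le> r'" using r(2) r''(2) n(4) by linarith+
      have "shadows 2 (\<delta> / 2) (r - r') (real n) (\<phi> (x, r')) x\<^sub>0"
        using shadows_sym[OF r(5)] by simp
      from shadows_trans[OF this r''(4)] le
      have "shadows 4 \<delta> (r - r') (r' - r'') (\<phi> (x, r')) (\<phi> (x, r''))" by simp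
      moreover have "\<phi> (\<phi> (x, r'), r - r') = \<phi> (x, r)" "\<phi> (\<phi> (x, r''), r' - r'') = \<phi> (x, r')"
        using x r(1) r''(1) le by (simp_all add: flow_add)
      ultimately have "shadows 4 \<delta> (r - r' + (p - r)) (r' - r'' + B) (\<phi> (x, r')) (\<phi> (x, r''))"
        using r(1,3,6) r''(1) x le by (intro shadows_concat) auto
      then have "\<exists>B. shadows 4 \<delta> (p - r') B (\<phi> (x, r')) (\<phi> (x, r''))" by auto
      then show ?thesis using r'' r(3) le unfolding pass_def by auto
    qed
    \<comment> \<open>Every pass goes back by at least \<open>real n / 2\<close>, which exceeds 1,
      so the passes stop when less than \<open>2 * real n + 2\<close> of time is left before
      them.\<close>
    have last_pass: "\<exists>r r'. pass r r' \<and> r' < 2 * real n + 2" if "pass r r'" "r' \<le> real q" for q r r'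
      using that
    proof (induction q arbitrary: r r')
      case 0
      then have "r' < 2 * real n + 2" using n(4) by auto
      then show ?case using 0 by blast
    next
      case (Suc q)
      show ?case
      proof (cases "r' < 2 * real n + 2")
        case True
        then show ?thesis using Suc.prems by blast
      next
        case False
        then obtain r'' where r'': "pass r' r''" using next_pass Suc.prems(1) by (meson not_less)
        then have "r'' \<le> r' - real n / 2" by (simp add: pass_def)
        then have "r'' \<le> real q" using Suc.prems(2) n(2) T_pos by simp
        then show ?thesis using Suc.IH r'' by blast
      qed
    qed
    obtain s where "pass p s" using first_pass by blast
    moreover obtain q where "s \<le> real q" using real_arch_simple by blast
    ultimately obtain r r' where pass: "pass r r'" and r': "r' < 2 * real n + 2" using last_pass by blast
    obtain B where r: "0 \<le> r'" "real n / 2 \<le> r - r'"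
      "shadows 2 (\<delta> / 2) (real n) (r - r') x\<^sub>0 (\<phi> (x, r'))"
      "shadows 4 \<delta> (p - r) B (\<phi> (x, r)) (\<phi> (x, r'))"
      using pass unfolding pass_def by blast
    have "r - r' \<le> 2 * real n" using shadows_length(2)[OF r(3)] n(4) by simp
    then have "r \<le> D" using r' n by linarith
    then have "N \<le> p - r" using p by linarith
    moreover have "0 \<le> r" using r n by linarith
    ultimately obtain \<tau> where \<tau>: "\<tau> \<in> {0..T}"
      "dist (\<phi> (x, r')) (\<phi> (\<phi> (x, r), \<tau>)) < e \<or> dist (\<phi> (x, r)) (\<phi> (\<phi> (x, r'), \<tau>)) < e"
      using N(2)[OF _ _ _ r(4)] x r(1) by auto
    from \<tau>(2) show ?thesis
    proof
      assume "dist (\<phi> (x, r')) (\<phi> (\<phi> (x, r), \<tau>)) < e"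
      then have "dist (\<phi> (x, r')) (\<phi> (x, r + \<tau>)) < e" using x \<open>0 \<le> r\<close> \<tau>(1) by (simp add: flow_add)
      moreover have "r' + 1 \<le> r + \<tau>" "r + \<tau> \<le> D + T" using r(2) n(2) \<tau>(1) T_pos \<open>r \<le> D\<close> by auto
      ultimately show ?thesis using r(1) by blast
    next
      assume "dist (\<phi> (x, r)) (\<phi> (\<phi> (x, r'), \<tau>)) < e"
      then have "dist (\<phi> (x, r' + \<tau>)) (\<phi> (x, r)) < e"
        using x r(1) \<tau>(1) by (simp add: flow_add dist_commute)
      moreover have "r' + \<tau> + 1 \<le> r" "r \<le> D + T" "0 \<le> r' + \<tau>"
        using r(1,2) n(2) \<tau>(1) T_pos \<open>r \<le> D\<close> by auto
      ultimately show ?thesis by blast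
    qed
  qed
  \<comment> \<open>Almost returns at bounded times give an exact one by compactness. The gap of at
    least 1 prevents the two times from coinciding in the limit, and injectivity then moves the
    return to \<open>x\<close> itself.\<close>
  define S where "S = ({0..D + T} \<times> {0..D + T}) \<inter> {z. fst z + 1 \<le> snd z}"
  have "compact S" unfolding S_def
    by (intro compact_Int_closed compact_Times closed_Collect_le continuous_intros) auto
  moreover have "S \<noteq> {}"
  proof -
    obtain u v where "0 \<le> u" "u + 1 \<le> v" "v \<le> D + T" using almost[OF zero_less_one] by blast
    then have "(u, v) \<in> S" by (simp add: S_def)
    then show ?thesis by blast
  qed
  moreover have "continuous_on S (\<lambda>z. dist (\<phi> (x, fst z)) (\<phi> (x, snd z)))"
    using x by (intro continuous_intros) (auto simp: S_def)
  ultimately obtain z where z: "z \<in> S" "\<And>z'. z' \<in> S \<Longrightarrow>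
      dist (\<phi> (x, fst z)) (\<phi> (x, snd z)) \<le> dist (\<phi> (x, fst z')) (\<phi> (x, snd z'))"
    using continuous_attains_inf[of S] by blast
  have "\<not> 0 < dist (\<phi> (x, fst z)) (\<phi> (x, snd z))"
  proof
    assume "0 < dist (\<phi> (x, fst z)) (\<phi> (x, snd z))"
    then obtain u v where "0 \<le> u" "u + 1 \<le> v" "v \<le> D + T"
      "dist (\<phi> (x, u)) (\<phi> (x, v)) < dist (\<phi> (x, fst z)) (\<phi> (x, snd z))"
      using almost by blast
    then show False using z(2)[of "(u, v)"] by (auto simp: S_def)
  qed
  then have "\<phi> (x, fst z) = \<phi> (\<phi> (x, snd z - fst z), fst z)"
    using x z(1) by (auto simp: S_def flow_add)
  from flow_inj[OF x _ _ this] have "x = \<phi> (x, snd z - fst z)" using x z(1) by (auto simp: S_def)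
  moreover have "0 < snd z - fst z" using z(1) by (auto simp: S_def)
  ultimately show thesis using that[OF _ sym] by blast
qed

text \<open>A periodic point lies in its own arbitrarily late future. So closeness of two points
  counts as closeness at late times, and contraction of the past brings their orbits arbitrarily
  close together. Different orbits are disjoint compact sets, a positive distance apart; hence
  \<eta>-close points share their orbit.\<close>

lemma finite_pos_orbits: "finite (pos_orbit \<phi> ` X)"
proof -
  obtain \<eta> where \<eta>: "0 < \<eta>"
    "\<And>e. 0 < e \<Longrightarrow> \<exists>n\<^sub>0. \<forall>n\<ge>n\<^sub>0. \<forall>x\<in>X. \<forall>y\<in>X. \<forall>b.
      dist (\<phi> (x, real n)) (\<phi> (y, b)) < \<eta> \<and> 2 * real n + 2 \<le> b \<longrightarrow>
      (\<exists>b'. 0 \<le> b' \<and> b' \<le> b \<and> dist x (\<phi> (y, b')) < e \<and>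
        shadows 2 (\<delta> / 2) (real n) (b - b') x (\<phi> (y, b')))"
    using backward_shadowing by metis
  have eq: "pos_orbit \<phi> x = pos_orbit \<phi> y" if x: "x \<in> X" and y: "y \<in> pos_orbit \<phi> x" for x y
  proof
    have "y \<in> X" using x y by (auto simp: pos_orbit_def)
    obtain P where "0 < P" "\<phi> (x, P) = x" using all_points_periodic[OF x] .
    then have "x \<in> pos_orbit \<phi> y" by (rule periodic_pos_orbit_sym[OF x _ _ y])
    then show "pos_orbit \<phi> x \<subseteq> pos_orbit \<phi> y" by (rule pos_orbit_trans[OF \<open>y \<in> X\<close>])
    show "pos_orbit \<phi> y \<subseteq> pos_orbit \<phi> x" using x y by (rule pos_orbit_trans)
  qed
  have same: "pos_orbit \<phi> x = pos_orbit \<phi> y" if x: "x \<in> X" and y: "y \<in> X" and "dist x y < \<eta>" for x y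
  proof (rule ccontr)
    assume ne: "pos_orbit \<phi> x \<noteq> pos_orbit \<phi> y"
    obtain P where P: "0 < P" "\<phi> (x, P) = x" using all_points_periodic[OF x] .
    obtain Q where Q: "0 < Q" "\<phi> (y, Q) = y" using all_points_periodic[OF y] .
    have "pos_orbit \<phi> x \<inter> pos_orbit \<phi> y = {}"
    proof (rule equals0I)
      fix w assume "w \<in> pos_orbit \<phi> x \<inter> pos_orbit \<phi> y"
      then have "pos_orbit \<phi> x = pos_orbit \<phi> w" "pos_orbit \<phi> y = pos_orbit \<phi> w"
        using eq[OF x, of w] eq[OF y, of w] by simp_all
      then show False using ne by simp
    qed
    from separate_compact[OF periodic_compact_pos_orbit[OF x P] periodic_compact_pos_orbit[OF y Q] this]
    obtain d where d: "0 < d" "\<And>u v. u \<in> pos_orbit \<phi> x \<Longrightarrow> v \<in> pos_orbit \<phi> y \<Longrightarrow> d \<le> dist u v"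
      by blast
    obtain n where n: "\<And>x y b. \<lbrakk>x \<in> X; y \<in> X; dist (\<phi> (x, real n)) (\<phi> (y, b)) < \<eta>; 2 * real n + 2 \<le> b\<rbrakk>
        \<Longrightarrow> \<exists>b'. 0 \<le> b' \<and> dist x (\<phi> (y, b')) < d"
      using \<eta>(2)[OF d(1)] by blast
    obtain t where t: "real n \<le> t" "\<phi> (x, t) = x" using periodic_late_return[OF x P] by metis
    obtain b where b: "2 * real n + 2 \<le> b" "\<phi> (y, b) = y" using periodic_late_return[OF y Q] by metis
    have "\<phi> (\<phi> (x, t - real n), real n) = x" using x t by (simp add: flow_add)
    then obtain b' where "0 \<le> b'" "dist (\<phi> (x, t - real n)) (\<phi> (y, b')) < d"
      using n[of "\<phi> (x, t - real n)" y b] x y t(1) b \<open>dist x y < \<eta>\<close> by auto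
    then show False using d(2)[of "\<phi> (x, t - real n)" "\<phi> (y, b')"] t(1) by (force simp: pos_orbit_def)
  qed
  obtain C where C: "finite C" "X \<subseteq> (\<Union>c\<in>C. ball c (\<eta> / 2))"
    using compact_X \<eta>(1) unfolding compact_eq_totally_bounded by (meson half_gt_zero)
  have "finite (pos_orbit \<phi> ` (X \<inter> ball c (\<eta> / 2)))" for c
  proof (cases "X \<inter> ball c (\<eta> / 2) = {}")
    case False
    then obtain x where x: "x \<in> X" "dist c x < \<eta> / 2" by auto
    have "pos_orbit \<phi> y = pos_orbit \<phi> x" if "y \<in> X \<inter> ball c (\<eta> / 2)" for y
      using that x by (intro same) (auto intro: dist_triangle_half_r)
    then have "pos_orbit \<phi> ` (X \<inter> ball c (\<eta> / 2)) \<subseteq> {pos_orbit \<phi> x}" by auto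
    then show ?thesis by (rule finite_subset) simp
  qed auto
  then have "finite (\<Union>c\<in>C. pos_orbit \<phi> ` (X \<inter> ball c (\<eta> / 2)))" using C(1) by blast
  moreover have "pos_orbit \<phi> ` X \<subseteq> (\<Union>c\<in>C. pos_orbit \<phi> ` (X \<inter> ball c (\<eta> / 2)))"
  proof (rule image_subsetI)
    fix x assume "x \<in> X"
    moreover from this obtain c where "c \<in> C" "x \<in> ball c (\<eta> / 2)" using C(2) by blast
    ultimately show "pos_orbit \<phi> x \<in> (\<Union>c\<in>C. pos_orbit \<phi> ` (X \<inter> ball c (\<eta> / 2)))" by blast
  qed
  ultimately show ?thesis by (rule rev_finite_subset)
qed

end

section \<open>Assembly of the decomposition\<close>

theorem theorem1p2:
  fixes X :: "'a::metric_space set" and \<phi> :: "'a \<times> real \<Rightarrow> 'a"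
  assumes "compact X"
    and "continuous_semiflow X \<phi>"
    and "positive_expansive X \<phi>"
  shows "\<exists>F. finite F \<and>
           (\<forall>A\<in>F. closed_orbit X \<phi> A \<or> unbranched_tail X \<phi> A \<or>
                   (\<exists>x. isolated_singularity X \<phi> x \<and> A = {x})) \<and>
           X = \<Union>F"
proof -
  interpret expansive_semiflow X \<phi>
    using assms by unfold_locales
  define K where "K = restless_points"
  have KX: "K \<subseteq> X" by (auto simp: K_def restless_points_def)
  interpret K: expansive_semiflow K \<phi>
  proof
    show "compact K" using compact_restless_points by (simp add: K_def)
    have "\<phi> ` (K \<times> {0..}) \<subseteq> K" using restless_points_invariant by (auto simp: K_def)
    moreover have "continuous_on (K \<times> {0..}) \<phi>"
      using assms(2) KX unfolding continuous_semiflow_def by (blast intro: continuous_on_subset)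
    moreover have "\<forall>x\<in>K. \<phi> (x, 0) = x" using KX flow_0 by blast
    moreover have "\<forall>x\<in>K. \<forall>t\<ge>0. \<forall>s\<ge>0. \<phi> (x, t + s) = \<phi> (\<phi> (x, t), s)"
      using assms(2) KX unfolding continuous_semiflow_def by blast
    ultimately show "continuous_semiflow K \<phi>" unfolding continuous_semiflow_def by blast
    show "positive_expansive K \<phi>"
      unfolding positive_expansive_def
    proof (intro allI impI)
      fix \<epsilon> :: real assume "0 < \<epsilon>"
      then obtain \<delta> where "0 < \<delta>"
        "\<And>x y s. \<lbrakk>x \<in> X; y \<in> X; s \<in> Hplus; \<And>t. 0 \<le> t \<Longrightarrow> dist (\<phi> (x, t)) (\<phi> (y, s t)) < \<delta>\<rbrakk>
          \<Longrightarrow> \<exists>t\<^sub>0\<in>{0..<\<epsilon>}. y = \<phi> (x, t\<^sub>0) \<or> x = \<phi> (y, t\<^sub>0)"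
        using expansiveE by blast
      then show "\<exists>\<delta>>0. \<forall>x\<in>K. \<forall>y\<in>K. \<forall>s\<in>Hplus.
          (\<forall>t\<ge>0. dist (\<phi> (x, t)) (\<phi> (y, s t)) < \<delta>) \<longrightarrow>
          (\<exists>t\<^sub>0\<in>{0..<\<epsilon>}. y = \<phi> (x, t\<^sub>0) \<or> x = \<phi> (y, t\<^sub>0))"
        using KX by (intro exI[of _ \<delta>] conjI) blast+
    qed
  qed
  have "K.rest_points = {}"
  proof (rule ccontr)
    assume "K.rest_points \<noteq> {}"
    then obtain p where p: "p \<in> K" "\<And>t. 0 \<le> t \<Longrightarrow> \<phi> (p, t) = p" by (auto simp: K.rest_points_def)
    then have "p \<in> rest_points" using KX by (auto simp: rest_points_def)
    moreover have "\<phi> (p, 0) \<notin> rest_points" using p(1) unfolding K_def restless_points_def by blast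
    ultimately show False using p(2)[of 0] by simp
  qed
  then obtain T \<delta> where "regular_semiflow K \<phi> T \<delta>" using K.regular_if_no_rest_points by blast
  then interpret R: regular_semiflow K \<phi> T \<delta> .
  \<comment> \<open>A rest point contributes its pre-orbit in either case: the tail if it is an end
    point, otherwise just the point. In the latter case the neighbourhood that it attracts is
    contained in this one point, which is therefore isolated.\<close>
  define F where "F = pos_orbit \<phi> ` K \<union> pre_orbit X \<phi> ` rest_points"
  have fin: "finite F" unfolding F_def using R.finite_pos_orbits finite_rest_points by auto
  have closed_orbits: "closed_orbit X \<phi> A" if "A \<in> pos_orbit \<phi> ` K" for A
  proof -
    from that obtain x where x: "x \<in> K" "A = pos_orbit \<phi> x" by blast
    have "\<phi> (x, T) \<in> pos_orbit \<phi> x" "\<phi> (x, T) \<noteq> x"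
      using R.no_return[OF x(1), of T] R.T_pos by (auto simp: pos_orbit_def)
    then have "pos_orbit \<phi> x \<noteq> {x}" by auto
    then have "periodic_point X \<phi> x"
      using R.all_points_periodic[OF x(1)] x(1) KX unfolding periodic_point_def by (metis subsetD)
    then show ?thesis using x(2) unfolding closed_orbit_def by blast
  qed
  have tails: "unbranched_tail X \<phi> A \<or> (\<exists>x. isolated_singularity X \<phi> x \<and> A = {x})"
    if "A \<in> pre_orbit X \<phi> ` rest_points" for A
  proof -
    from that obtain p where p: "p \<in> rest_points" "A = pre_orbit X \<phi> p" by blast
    have pX: "p \<in> X" using p(1) by (rule rest_points_in)
    have "pos_orbit \<phi> p \<subseteq> {p}" using rest_points_fixed[OF p(1)] by (auto simp: pos_orbit_def)
    then have orb: "pos_orbit \<phi> p = {p}" using pos_orbit_refl[OF pX] by blast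
    show ?thesis
    proof (cases "A = {p}")
      case True
      obtain \<eta> where \<eta>: "0 < \<eta>" "\<And>x. x \<in> X \<Longrightarrow> dist x p < \<eta> \<Longrightarrow> \<exists>t\<ge>0. \<phi> (x, t) = p"
        using rest_point_attracting[OF p(1)] by blast
      have "x = p" if "x \<in> X" "dist x p < \<eta>" for x
      proof -
        have "x \<in> pre_orbit X \<phi> p" using \<eta>(2)[OF that] that(1) by (auto simp: pre_orbit_def)
        then show ?thesis using True p(2) by simp
      qed
      then have "p isolated_in X" using pX \<eta>(1) unfolding isolated_in_dist_Ex_iff by (metis dist_commute)
      then show ?thesis
        using True p(2) orb pX by (auto simp: isolated_singularity_def singularity_def)
    next
      case False
      then have "end_point X \<phi> p" using orb pX p(2) by (simp add: end_point_def)
      then show ?thesis using rest_point_unbranched[OF p(1)] p(2) by (auto simp: unbranched_tail_def)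
    qed
  qed
  have cover: "X = \<Union>F"
  proof
    show "X \<subseteq> \<Union>F"
    proof
      fix x assume x: "x \<in> X"
      show "x \<in> \<Union>F"
      proof (cases "x \<in> K")
        case True
        then show ?thesis using pos_orbit_refl[OF x] by (auto simp: F_def)
      next
        case False
        then obtain t where "0 \<le> t" "\<phi> (x, t) \<in> rest_points"
          using x by (auto simp: K_def restless_points_def)
        then show ?thesis using x by (force simp: F_def pre_orbit_def)
      qed
    qed
    show "\<Union>F \<subseteq> X" using KX by (auto simp: F_def pos_orbit_def pre_orbit_def)
  qed
  have "closed_orbit X \<phi> A \<or> unbranched_tail X \<phi> A \<or> (\<exists>x. isolated_singularity X \<phi> x \<and> A = {x})"
    if "A \<in> F" for A
    using that closed_orbits[of A] tails[of A] unfolding F_def by (elim UnE) simp_all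
  with fin cover show ?thesis by (intro exI[of _ F] conjI ballI)
qed

end
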